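(* We have $\Gamma_M^{\mathrm{aut}}=G_{\mathrm{Hor}}=\Gamma^{\max}$. In particular, any element of $\Gamma^{\max}$ is a $\nu$-automorphism.
   Context: Let $A=\mathbb Z[s_1,s_2,s_3^{\pm1}]$, identified with the ring of symmetric Laurent polynomials in $z_1,z_2,z_3$ with integer coefficients ($s_i$ being the $i$-th elementary symmetric function), with the involution $f^*(s_1,s_2,s_3)=f(s_2/s_3,s_1/s_3,1/s_3)$. Let $\mathcal R=A[x_1,\dots,x_6]$. Define the ring involution $\nu$ of $\mathcal R$ acting on coefficients by $*$ and on variables by $x_1\leftrightarrow x_2$, $x_3\leftrightarrow x_4$, $x_5\leftrightarrow x_6$. A $\nu$-endomorphism of $\mathcal R$ is an $A$-algebra endomorphism $\phi$ with $\phi(\nu f)=\nu\phi(f)$ for all $f$; it is a $\nu$-automorphism if invertible. A $\nu$-endomorphism is determined by the triple $(P,Q,R)=(\phi(x_1),\phi(x_3),\phi(x_5))\in\mathcal R^3$, which may be arbitrary; then $x_2\mapsto\nu P$, $x_4\mapsto\nu Q$, $x_6\mapsto\nu R$. $\Gamma_M^{\mathrm{aut}}$ is the group of $\nu$-automorphisms generated by the following ones (given by the images of $x_1,x_3,x_5$): $\Lambda_{i,j}$: $x_1\mapsto(-1)^ix_1,\ x_3\mapsto(-1)^{i+j}x_3,\ x_5\mapsto(-1)^jx_5$ ($i,j\in\mathbb Z/2$); $\Sigma_1$: $x_1\mapsto x_3,\ x_3\mapsto x_1,\ x_5\mapsto x_5$; $\Sigma_2$: $x_1\mapsto x_1,\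 x_3\mapsto x_5,\ x_5\mapsto x_3$; $T_1$: $x_1\mapsto-x_2,\ x_3\mapsto x_6-x_1x_3,\ x_5\mapsto x_4$; $T_2$: $x_1\mapsto x_4-x_1x_5,\ x_3\mapsto x_2,\ x_5\mapsto-x_6$; $M_{i,j}$: $x_1\mapsto s_3^{-i}x_1,\ x_3\mapsto s_3^{i+j}x_3,\ x_5\mapsto s_3^{-j}x_5$ ($i,j\in\mathbb Z$). Let $H=x_1x_2+x_3x_4+x_5x_6-x_1x_3x_5$. $G_{\mathrm{Hor}}$ is the group of $\nu$-automorphisms of $\mathcal R$ which preserve $H$. For $p\in\mathbb C^3$ with nonzero coordinates, specializing the coefficients at $(z_1,z_2,z_3)=p$ turns a $\nu$-endomorphism $\phi$ with triple $(P,Q,R)$ into the polynomial map $\phi_p:\mathbb C^6\to\mathbb C^6$, $q\mapsto(P_p(q),(\nu P)_p(q),Q_p(q),(\nu Q)_p(q),R_p(q),(\nu R)_p(q))$. The $\nu$-endomorphism $\phi$ is of maximal rank if there exist such $p$ and $q\in\mathbb C^6$ such that the Jacobian matrix of $\phi_p$ at $q$ is invertible. $\Gamma^{\max}$ is the set of $\nu$-endomorphisms of $\mathcal R$ of maximal rank which preserve $H$ (i.e. $\phi(H)=H$). *)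

theory Defs
  imports
    "HOL-Analysis.Analysis"
    "HOL-Library.Poly_Mapping"
    "HOL-Library.Product_Plus"
    "HOL-Algebra.Generated_Groups"
begin

text \<open>
  The ring \<open>A = \<int>[s\<^sub>1, s\<^sub>2, s\<^sub>3\<^sup>\<plusminus>\<^sup>1]\<close> is the monoid ring of \<open>\<nat> \<times> \<nat> \<times> \<int>\<close> over the integers: the key
  \<open>(a, b, c)\<close> stands for the monomial \<open>s\<^sub>1\<^sup>a s\<^sub>2\<^sup>b s\<^sub>3\<^sup>c\<close>. The ring structure is that of
  \<^type>\<open>poly_mapping\<close> (convolution product).
\<close>

type_synonym coeffs = "(nat \<times> nat \<times> int) \<Rightarrow>\<^sub>0 int"

definition sym1 :: coeffs where "sym1 = Poly_Mapping.single (1, 0, 0) 1"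
definition sym2 :: coeffs where "sym2 = Poly_Mapping.single (0, 1, 0) 1"

definition sym3_pow :: "int \<Rightarrow> coeffs" where
  "sym3_pow i = Poly_Mapping.single (0, 0, i) 1"

text \<open>
  Value of an element of \<open>A\<close> under \<open>s\<^sub>1 \<mapsto> u, s\<^sub>2 \<mapsto> v, s\<^sub>3 \<mapsto> w\<close> in a commutative ring;
  \<open>w'\<close> has to be the inverse of \<open>w\<close>.
\<close>

definition eval_coeffs :: "'b \<Rightarrow> 'b \<Rightarrow> 'b \<Rightarrow> 'b \<Rightarrow> coeffs \<Rightarrow> 'b::comm_ring_1" where
  "eval_coeffs u v w w' f =
    (\<Sum>(a, b, c) \<in> Poly_Mapping.keys f. of_int (Poly_Mapping.lookup f (a, b, c)) *
       u ^ a * v ^ b * (if c \<ge> 0 then w ^ nat c else w' ^ nat (- c)))"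

definition star :: "coeffs \<Rightarrow> coeffs" where
  "star = eval_coeffs (sym2 * sym3_pow (- 1)) (sym1 * sym3_pow (- 1)) (sym3_pow (- 1)) (sym3_pow 1)"

text \<open>
  Specialization of the coefficients at \<open>(z\<^sub>1, z\<^sub>2, z\<^sub>3)\<close>, where \<open>s\<^sub>i\<close> is the \<open>i\<close>-th elementary
  symmetric function of the \<open>z\<^sub>j\<close>.
\<close>

definition spec_coeffs :: "complex \<times> complex \<times> complex \<Rightarrow> coeffs \<Rightarrow> complex" where
  "spec_coeffs = (\<lambda>(z1, z2, z3).
     eval_coeffs (z1 + z2 + z3) (z1 * z2 + z1 * z3 + z2 * z3) (z1 * z2 * z3)
       (inverse (z1 * z2 * z3)))"

datatype var = V1 | V2 | V3 | V4 | V5 | V6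

lemma UNIV_var: "(UNIV :: var set) = {V1, V2, V3, V4, V5, V6}"
  using var.exhaust by auto

instance var :: finite
  by standard (simp add: UNIV_var)

text \<open>The ring \<open>\<R> = A[x\<^sub>1, \<dots>, x\<^sub>6]\<close>; the keys are the exponent vectors of the monomials.\<close>

type_synonym ring_R = "(var \<Rightarrow>\<^sub>0 nat) \<Rightarrow>\<^sub>0 coeffs"

definition coeff_const :: "coeffs \<Rightarrow> ring_R" where
  "coeff_const a = Poly_Mapping.single 0 a"

definition xvar :: "var \<Rightarrow> ring_R" where
  "xvar v = Poly_Mapping.single (Poly_Mapping.single v 1) 1"

text \<open>Apply \<open>h\<close> to the coefficients and substitute \<open>g v\<close> for the variable \<open>v\<close>.\<close>

definition subst_poly :: "(coeffs \<Rightarrow> 'b) \<Rightarrow> (var \<Rightarrow> 'b) \<Rightarrow> ring_R \<Rightarrow> 'b::comm_ring_1" where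
  "subst_poly h g f =
    (\<Sum>m \<in> Poly_Mapping.keys f. h (Poly_Mapping.lookup f m) *
       (\<Prod>v \<in> UNIV. g v ^ Poly_Mapping.lookup m v))"

fun swap_var :: "var \<Rightarrow> var" where
  "swap_var V1 = V2" | "swap_var V2 = V1"
| "swap_var V3 = V4" | "swap_var V4 = V3"
| "swap_var V5 = V6" | "swap_var V6 = V5"

definition nu :: "ring_R \<Rightarrow> ring_R" where
  "nu = subst_poly (\<lambda>a. coeff_const (star a)) (\<lambda>v. xvar (swap_var v))"

definition A_algebra_endo :: "(ring_R \<Rightarrow> ring_R) \<Rightarrow> bool" where
  "A_algebra_endo \<phi> \<longleftrightarrow>
     (\<forall>f g. \<phi> (f + g) = \<phi> f + \<phi> g) \<and> (\<forall>f g. \<phi> (f * g) = \<phi> f * \<phi> g) \<and>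
     (\<forall>a. \<phi> (coeff_const a) = coeff_const a)"

definition nu_endo :: "(ring_R \<Rightarrow> ring_R) \<Rightarrow> bool" where
  "nu_endo \<phi> \<longleftrightarrow> A_algebra_endo \<phi> \<and> (\<forall>f. \<phi> (nu f) = nu (\<phi> f))"

definition nu_auto :: "(ring_R \<Rightarrow> ring_R) \<Rightarrow> bool" where
  "nu_auto \<phi> \<longleftrightarrow> nu_endo \<phi> \<and> (\<exists>\<psi>. nu_endo \<psi> \<and> \<phi> \<circ> \<psi> = id \<and> \<psi> \<circ> \<phi> = id)"

definition nu_auto_group :: "(ring_R \<Rightarrow> ring_R) monoid" where
  "nu_auto_group = \<lparr>carrier = {\<phi>. nu_auto \<phi>}, mult = (\<circ>), one = id\<rparr>"

text \<open>The images of the variables under the \<open>\<nu>\<close>-endomorphism with triple \<open>(P, Q, R)\<close>.\<close>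

fun images :: "ring_R \<Rightarrow> ring_R \<Rightarrow> ring_R \<Rightarrow> var \<Rightarrow> ring_R" where
  "images P Q R V1 = P" | "images P Q R V2 = nu P"
| "images P Q R V3 = Q" | "images P Q R V4 = nu Q"
| "images P Q R V5 = R" | "images P Q R V6 = nu R"

definition endo_of :: "ring_R \<Rightarrow> ring_R \<Rightarrow> ring_R \<Rightarrow> ring_R \<Rightarrow> ring_R" where
  "endo_of P Q R = subst_poly coeff_const (images P Q R)"

text \<open>The indices \<open>i, j \<in> \<int>/2\<close> are represented by 0 and 1 below.\<close>

definition Lambda_gen :: "nat \<Rightarrow> nat \<Rightarrow> ring_R \<Rightarrow> ring_R" where
  "Lambda_gen i j =
     endo_of ((- 1) ^ i * xvar V1) ((- 1) ^ (i + j) * xvar V3) ((- 1) ^ j * xvar V5)"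

definition Sigma1_gen :: "ring_R \<Rightarrow> ring_R" where
  "Sigma1_gen = endo_of (xvar V3) (xvar V1) (xvar V5)"

definition Sigma2_gen :: "ring_R \<Rightarrow> ring_R" where
  "Sigma2_gen = endo_of (xvar V1) (xvar V5) (xvar V3)"

definition T1_gen :: "ring_R \<Rightarrow> ring_R" where
  "T1_gen = endo_of (- xvar V2) (xvar V6 - xvar V1 * xvar V3) (xvar V4)"

definition T2_gen :: "ring_R \<Rightarrow> ring_R" where
  "T2_gen = endo_of (xvar V4 - xvar V1 * xvar V5) (xvar V2) (- xvar V6)"

definition M_gen :: "int \<Rightarrow> int \<Rightarrow> ring_R \<Rightarrow> ring_R" where
  "M_gen i j = endo_of (coeff_const (sym3_pow (- i)) * xvar V1)
     (coeff_const (sym3_pow (i + j)) * xvar V3)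
     (coeff_const (sym3_pow (- j)) * xvar V5)"

definition Gamma_M_aut :: "(ring_R \<Rightarrow> ring_R) set" where
  "Gamma_M_aut = generate nu_auto_group
     ({Lambda_gen i j | i j. i \<in> {0, 1} \<and> j \<in> {0, 1}} \<union>
      {Sigma1_gen, Sigma2_gen, T1_gen, T2_gen} \<union>
      {M_gen i j | i j. True})"

definition H_poly :: ring_R where
  "H_poly =
     xvar V1 * xvar V2 + xvar V3 * xvar V4 + xvar V5 * xvar V6 - xvar V1 * xvar V3 * xvar V5"

definition G_Hor :: "(ring_R \<Rightarrow> ring_R) set" where
  "G_Hor = {\<phi>. nu_auto \<phi> \<and> \<phi> H_poly = H_poly}"

definition spec_map ::
  "(ring_R \<Rightarrow> ring_R) \<Rightarrow> complex \<times> complex \<times> complex \<Rightarrow> complex ^ var \<Rightarrow> complex ^ var" where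
  "spec_map \<phi> p q =
    (\<chi> v. subst_poly (spec_coeffs p) (\<lambda>w. q $ w) (images (\<phi> (xvar V1)) (\<phi> (xvar V3)) (\<phi> (xvar V5)) v))"

text \<open>
  The matrix of complex partial derivatives; the library's \<^const>\<open>frechet_derivative\<close> and
  \<^const>\<open>jacobian\<close> refer to real derivatives.
\<close>

definition complex_jacobian ::
  "(complex ^ 'n \<Rightarrow> complex ^ 'm) \<Rightarrow> complex ^ 'n \<Rightarrow> complex ^ 'n ^ 'm" where
  "complex_jacobian F q =
    (\<chi> i j. deriv (\<lambda>t. F (\<chi> k. if k = j then t else q $ k) $ i) (q $ j))"

definition maximal_rank :: "(ring_R \<Rightarrow> ring_R) \<Rightarrow> bool" where
  "maximal_rank \<phi> \<longleftrightarrow>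
    (\<exists>z1 z2 z3 q. z1 \<noteq> 0 \<and> z2 \<noteq> 0 \<and> z3 \<noteq> 0 \<and>
       invertible (complex_jacobian (spec_map \<phi> (z1, z2, z3)) q))"

definition Gamma_max :: "(ring_R \<Rightarrow> ring_R) set" where
  "Gamma_max = {\<phi>. nu_endo \<phi> \<and> maximal_rank \<phi> \<and> \<phi> H_poly = H_poly}"

lemma nu_endo_id: "nu_endo id"
  by (simp add: nu_endo_def A_algebra_endo_def)

lemma nu_endo_comp: "nu_endo \<phi> \<Longrightarrow> nu_endo \<psi> \<Longrightarrow> nu_endo (\<phi> \<circ> \<psi>)"
  by (simp add: nu_endo_def A_algebra_endo_def)

lemma nu_auto_comp:
  assumes "nu_auto \<phi>" and "nu_auto \<psi>"
  shows "nu_auto (\<phi> \<circ> \<psi>)"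
proof -
  from assms obtain \<phi>' \<psi>' where
    *: "nu_endo \<phi>'" "\<phi> \<circ> \<phi>' = id" "\<phi>' \<circ> \<phi> = id" "nu_endo \<psi>'" "\<psi> \<circ> \<psi>' = id" "\<psi>' \<circ> \<psi> = id"
    unfolding nu_auto_def by blast
  have "(\<phi> \<circ> \<psi>) \<circ> (\<psi>' \<circ> \<phi>') = id" "(\<psi>' \<circ> \<phi>') \<circ> (\<phi> \<circ> \<psi>) = id"
    using * by (simp_all add: fun_eq_iff)
  moreover have "nu_endo (\<psi>' \<circ> \<phi>')" "nu_endo (\<phi> \<circ> \<psi>)"
    using * assms by (simp_all add: nu_endo_comp nu_auto_def)
  ultimately show ?thesis
    unfolding nu_auto_def by blast
qed

lemma group_nu_auto_group: "group nu_auto_group"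
proof (rule groupI)
  fix \<phi> assume "\<phi> \<in> carrier nu_auto_group"
  then show "\<exists>\<psi>\<in>carrier nu_auto_group. \<psi> \<otimes>\<^bsub>nu_auto_group\<^esub> \<phi> = \<one>\<^bsub>nu_auto_group\<^esub>"
    by (auto simp: nu_auto_group_def nu_auto_def)
next
  show "\<one>\<^bsub>nu_auto_group\<^esub> \<in> carrier nu_auto_group"
    using nu_endo_id by (auto simp: nu_auto_group_def nu_auto_def)
qed (simp_all add: nu_auto_group_def nu_auto_comp comp_assoc)

end

theory Submission
  imports Defs "HOL-Computational_Algebra.Polynomial"
begin

text \<open>
  Write a \<open>\<nu>\<close>-endomorphism as its triple \<open>(P, Q, R)\<close>. It preserves \<open>H\<close> if and only if
  \<open>P \<nu>P + Q \<nu>Q + R \<nu>R - P Q R = H\<close>, an equation of Markov type, and the proof is a descent of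
  Markov type on the sum of the total degrees of \<open>P\<close>, \<open>Q\<close> and \<open>R\<close>.

  The inclusions \<^term>\<open>Gamma_M_aut \<subseteq> G_Hor\<close> and \<^term>\<open>G_Hor \<subseteq> Gamma_max\<close> are the easy ones.
  For the first, every generator preserves \<open>H\<close> and has an explicit inverse; for the second, the chain rule turns
  \<open>\<phi> \<circ> \<psi> = id\<close> into a factorization of the identity matrix, so that the Jacobian matrix of an
  automorphism is invertible at every point.

  For \<^term>\<open>Gamma_max \<subseteq> Gamma_M_aut\<close> (\<open>Gamma_max_subset_Gamma_M_aut\<close>), let \<open>p \<ge> q, r\<close> be the
  total degrees of the triple. Maximal rank excludes constant components, which would give a zero row
  in the Jacobian matrix; thus \<open>p, q, r \<ge> 1\<close>. Suppose that \<open>p + q + r > 3\<close>. As \<open>H\<close> has degree 3,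
  the leading form of \<open>P Q R\<close>, which is nonzero because \<open>\<R>\<close> is a domain, has to be cancelled by that
  of \<open>P \<nu>P\<close>. This forces \<open>p = q + r\<close> and makes the leading form of \<open>\<nu>P\<close> that of \<open>Q R\<close>, so
  \<open>\<nu>P - Q R\<close> has smaller degree than \<open>P\<close> (\<open>tdeg_reduction\<close>). Up to signs, \<open>\<nu>\<close> and a permutation, replacing \<open>P\<close>
  by \<open>\<nu>P - Q R\<close> is composition on the right with \<open>T\<^sub>1\<close> or \<open>T\<^sub>2\<close>, and the result is again in \<^const>\<open>Gamma_max\<close>,
  by the chain rule. The descent stops when \<open>p = q = r = 1\<close>. Then the degree 3 part of the equation says that the
  three linear forms have the product \<open>x\<^sub>1 x\<^sub>3 x\<^sub>5\<close>, so after a permutation they are \<open>u x\<^sub>1\<close>, \<open>v x\<^sub>3\<close>,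
  \<open>w x\<^sub>5\<close> with \<open>u v w = 1\<close>, and the degree 2 part says that the constant terms vanish. The units
  of \<open>A\<close> are \<open>\<plusminus>s\<^sub>3\<^sup>k\<close> (\<open>coeffs_unit\<close>), hence what remains is a product of some \<open>\<Lambda>\<^sub>i\<^sub>,\<^sub>j\<close> and
  \<open>M\<^sub>k\<^sub>,\<^sub>l\<close>.
\<close>

section \<open>Homomorphisms from monoid rings\<close>

locale unital_ring_hom =
  fixes h :: "'a::comm_ring_1 \<Rightarrow> 'b::comm_ring_1"
  assumes hom_one [simp]: "h 1 = 1"
    and hom_add [simp]: "h (x + y) = h x + h y"
    and hom_mult [simp]: "h (x * y) = h x * h y"
begin

lemma hom_zero [simp]: "h 0 = 0"
  using hom_add[of 0 0] by simp

lemma hom_uminus [simp]: "h (- x) = - h x"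
  using hom_add[of x "- x"] by (simp add: add_eq_0_iff)

lemma hom_diff [simp]: "h (x - y) = h x - h y"
  using hom_add[of x "- y"] by simp

lemma hom_sum: "h (sum f A) = (\<Sum>x\<in>A. h (f x))"
  by (induction A rule: infinite_finite_induct) simp_all

lemma hom_power [simp]: "h (x ^ n) = h x ^ n"
  by (induction n) simp_all

lemma hom_of_int [simp]: "h (of_int k) = of_int k"
proof -
  have nat: "h (of_nat n) = of_nat n" for n
    by (induction n) simp_all
  show ?thesis
    by (cases k rule: int_cases2) (simp_all add: nat)
qed

end

lemma poly_mapping_eq_sum_single:
  "f = (\<Sum>k\<in>Poly_Mapping.keys f. Poly_Mapping.single k (Poly_Mapping.lookup f k))"
proof (rule poly_mapping_eqI)
  fix k
  show "Poly_Mapping.lookup f k = Poly_Mapping.lookup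
    (\<Sum>k\<in>Poly_Mapping.keys f. Poly_Mapping.single k (Poly_Mapping.lookup f k)) k"
    by (auto simp: lookup_sum lookup_single when_def in_keys_iff sum.delta)
qed

lemma poly_mapping_times_eq_sum:
  fixes f g :: "'k::comm_monoid_add \<Rightarrow>\<^sub>0 'a::comm_ring_1"
  shows "f * g = (\<Sum>k\<in>Poly_Mapping.keys f. \<Sum>l\<in>Poly_Mapping.keys g.
     Poly_Mapping.single (k + l) (Poly_Mapping.lookup f k * Poly_Mapping.lookup g l))"
  by (subst (1) poly_mapping_eq_sum_single[of f], subst (1) poly_mapping_eq_sum_single[of g])
    (simp add: sum_product mult_single)

text \<open>
  The universal property of a monoid ring: a homomorphism on the coefficients and a multiplicative
  map on the monoid extend to a ring homomorphism. Evaluation of coefficients, substitution of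
  polynomials, \<^term>\<open>star\<close> and \<^term>\<open>nu\<close> are all of this form.
\<close>

lemma unital_ring_hom_monoid_ring:
  fixes c :: "'a::comm_ring_1 \<Rightarrow> 'b::comm_ring_1" and e :: "'k::comm_monoid_add \<Rightarrow> 'b"
  assumes c: "unital_ring_hom c" and e0: "e 0 = 1" and e_add: "\<And>k l. e (k + l) = e k * e l"
  defines "\<Phi> \<equiv> \<lambda>f. \<Sum>k\<in>Poly_Mapping.keys f. c (Poly_Mapping.lookup f k) * e k"
  shows "unital_ring_hom \<Phi>" and "\<And>k a. \<Phi> (Poly_Mapping.single k a) = c a * e k"
proof -
  interpret c: unital_ring_hom c by (fact c)
  have sup: "\<Phi> f = (\<Sum>k\<in>K. c (Poly_Mapping.lookup f k) * e k)"
    if "finite K" "Poly_Mapping.keys f \<subseteq> K" for f K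
    unfolding \<Phi>_def using that by (intro sum.mono_neutral_left) (auto simp: in_keys_iff)
  have add: "\<Phi> (f + g) = \<Phi> f + \<Phi> g" for f g
  proof -
    let ?K = "Poly_Mapping.keys f \<union> Poly_Mapping.keys g"
    have "\<Phi> (f + g) = (\<Sum>k\<in>?K. c (Poly_Mapping.lookup (f + g) k) * e k)"
      by (intro sup) (simp_all add: Poly_Mapping.keys_add)
    also have "\<dots> = \<Phi> f + \<Phi> g"
      by (subst sup[of ?K f], simp, simp, subst sup[of ?K g])
        (simp_all add: lookup_add sum.distrib distrib_right)
    finally show ?thesis .
  qed
  have zero: "\<Phi> 0 = 0"
    by (simp add: \<Phi>_def)
  have \<Phi>_sum: "\<Phi> (sum F A) = (\<Sum>x\<in>A. \<Phi> (F x))" for F and A :: "'i set"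
    by (induction A rule: infinite_finite_induct) (simp_all add: zero add)
  show single: "\<Phi> (Poly_Mapping.single k a) = c a * e k" for k a
    by (cases "a = 0") (simp_all add: \<Phi>_def)
  show "unital_ring_hom \<Phi>"
  proof
    show "\<Phi> 1 = 1"
      using single[of 0 1] by (simp add: e0)
    show "\<Phi> (f * g) = \<Phi> f * \<Phi> g" for f g
    proof -
      have "\<Phi> (f * g) = (\<Sum>k\<in>Poly_Mapping.keys f. \<Sum>l\<in>Poly_Mapping.keys g.
          (c (Poly_Mapping.lookup f k) * e k) * (c (Poly_Mapping.lookup g l) * e l))"
        unfolding poly_mapping_times_eq_sum[of f g]
        by (subst \<Phi>_sum)+ (simp add: single e_add mult_ac)
      then show ?thesis
        by (simp add: \<Phi>_def sum_product)
    qed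
  qed (fact add)
qed

section \<open>Substitutions\<close>

lemma unital_ring_hom_eval_coeffs:
  assumes "w * w' = 1"
  shows "unital_ring_hom (eval_coeffs u v w w')"
    and "eval_coeffs u v w w' (Poly_Mapping.single (a, b, c) k) =
      of_int k * (u ^ a * v ^ b * (if c \<ge> 0 then w ^ nat c else w' ^ nat (- c)))"
proof -
  define pw where "pw c = (if c \<ge> 0 then w ^ nat c else w' ^ nat (- c))" for c :: int
  define e where "e = (\<lambda>(a, b, c). u ^ a * v ^ b * pw c)"
  have cancel: "w ^ (m + n) * w' ^ n = w ^ m" "w ^ n * w' ^ (m + n) = w' ^ m" for m n
  proof -
    have one: "w ^ n * w' ^ n = 1" for n
      using assms by (simp add: power_mult_distrib[symmetric])
    show "w ^ (m + n) * w' ^ n = w ^ m"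
      using one[of n] by (simp add: power_add mult.assoc)
    show "w ^ n * w' ^ (m + n) = w' ^ m"
      using one[of n] by (simp add: power_add mult.left_commute[of _ "w' ^ m"])
  qed
  \<comment> \<open>In terms of differences of natural numbers the powers of \<open>w\<close> and \<open>w'\<close> multiply without a
     case distinction on signs.\<close>
  have pw_diff: "pw (int m - int n) = w ^ m * w' ^ n" for m n
  proof (cases "n \<le> m")
    case True
    then show ?thesis using cancel(1)[of "m - n" n] by (simp add: pw_def nat_diff_distrib)
  next
    case False
    then show ?thesis using cancel(2)[of m "n - m"] by (simp add: pw_def nat_diff_distrib)
  qed
  have pw_add: "pw (c + d) = pw c * pw d" for c d
  proof -
    obtain m n m' n' where *: "c = int m - int n" "d = int m' - int n'"
      by (metis int_diff_cases)
    then have "c + d = int (m + m') - int (n + n')" by simp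
    then show ?thesis
      unfolding * by (simp only: pw_diff power_add mult_ac)
  qed
  have "unital_ring_hom (of_int :: int \<Rightarrow> 'a)"
    by standard simp_all
  note hom = unital_ring_hom_monoid_ring[OF this, of e]
  have e: "e 0 = 1" "e (k + l) = e k * e l" for k l
    by (simp add: e_def zero_prod_def pw_def)
      (cases k; cases l; simp add: e_def pw_add power_add mult_ac)
  have eq: "eval_coeffs u v w w' f =
      (\<Sum>k\<in>Poly_Mapping.keys f. of_int (Poly_Mapping.lookup f k) * e k)" for f
    unfolding eval_coeffs_def e_def pw_def by (rule sum.cong) (auto simp: mult.assoc)
  show "unital_ring_hom (eval_coeffs u v w w')"
    unfolding eq[abs_def] by (rule hom(1)[OF e])
  show "eval_coeffs u v w w' (Poly_Mapping.single (a, b, c) k) =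
      of_int k * (u ^ a * v ^ b * (if c \<ge> 0 then w ^ nat c else w' ^ nat (- c)))"
    unfolding eq hom(2)[OF e] by (simp add: e_def pw_def)
qed

lemma unital_ring_hom_subst_poly:
  assumes "unital_ring_hom h"
  shows "unital_ring_hom (subst_poly h g)"
    and "subst_poly h g (coeff_const a) = h a"
    and "subst_poly h g (xvar v) = g v"
proof -
  interpret unital_ring_hom h by fact
  define e where "e m = (\<Prod>v\<in>UNIV. g v ^ Poly_Mapping.lookup m v)" for m
  have e: "e 0 = 1" "e (k + l) = e k * e l" for k l
    by (simp_all add: e_def lookup_add power_add prod.distrib)
  note hom = unital_ring_hom_monoid_ring[OF assms e]
  have eq: "subst_poly h g f =
      (\<Sum>k\<in>Poly_Mapping.keys f. h (Poly_Mapping.lookup f k) * e k)" for f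
    unfolding subst_poly_def e_def ..
  show "unital_ring_hom (subst_poly h g)"
    unfolding eq[abs_def] by (rule hom(1))
  show "subst_poly h g (coeff_const a) = h a"
    unfolding eq coeff_const_def hom(2) by (simp add: e)
  have "e (Poly_Mapping.single v 1) = (\<Prod>w\<in>UNIV. if w = v then g w else 1)"
    unfolding e_def by (rule prod.cong) (auto simp: lookup_single when_def)
  then show "subst_poly h g (xvar v) = g v"
    unfolding eq xvar_def hom(2) by simp
qed

lemma unital_ring_hom_coeff_const: "unital_ring_hom coeff_const"
  by standard (simp_all add: coeff_const_def single_add mult_single)

lemma unital_ring_hom_comp:
  "unital_ring_hom g \<Longrightarrow> unital_ring_hom h \<Longrightarrow> unital_ring_hom (\<lambda>x. g (h x))"
  by (simp add: unital_ring_hom_def)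

interpretation coeff_const: unital_ring_hom coeff_const
  by (fact unital_ring_hom_coeff_const)

text \<open>
  This makes any statement that is stable under the ring operations, such as an identity between homomorphisms
  or the chain rule, a matter of constants and variables.
\<close>

lemma ring_R_induct [case_names const var add mult]:
  assumes const: "\<And>a. P (coeff_const a)" and var: "\<And>v. P (xvar v)"
    and add: "\<And>f g. P f \<Longrightarrow> P g \<Longrightarrow> P (f + g)" and mult: "\<And>f g. P f \<Longrightarrow> P g \<Longrightarrow> P (f * g)"
  shows "P f"
proof -
  have one: "P 1"
    using const[of 1] by simp
  have zero: "P 0"
    using const[of 0] by simp
  have pow: "P (xvar v ^ n)" for v n
    by (induction n) (simp_all add: one var mult)
  have prod: "P (prod F A)" if "\<And>x. P (F x)" for F and A :: "var set"
    by (induction A rule: infinite_finite_induct) (simp_all add: one that mult)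
  have sum: "P (sum F A)" if "\<And>x. P (F x)" for F and A :: "(var \<Rightarrow>\<^sub>0 nat) set"
    by (induction A rule: infinite_finite_induct) (simp_all add: zero that add)
  have xpow: "xvar v ^ n = Poly_Mapping.single (Poly_Mapping.single v n) 1" for v n
    by (induction n) (simp_all add: xvar_def mult_single single_add[symmetric])
  have xprod: "(\<Prod>v\<in>V. Poly_Mapping.single (F v) 1) =
      (Poly_Mapping.single (\<Sum>v\<in>V. F v) 1 :: ring_R)" if "finite V" for F and V :: "var set"
    using that by induction (simp_all add: mult_single)
  have m: "m = (\<Sum>v\<in>UNIV. Poly_Mapping.single v (Poly_Mapping.lookup m v))"
    for m :: "var \<Rightarrow>\<^sub>0 nat"
    by (rule poly_mapping_eqI) (simp add: lookup_sum lookup_single when_def)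
  have "Poly_Mapping.single m a =
      coeff_const a * (\<Prod>v\<in>UNIV. xvar v ^ Poly_Mapping.lookup m v)" for m a
    unfolding xpow coeff_const_def
    by (simp add: xprod mult_single m[symmetric])
  then have "P (Poly_Mapping.single m a)" for m a
    using const prod[of "\<lambda>v. xvar v ^ Poly_Mapping.lookup m v" UNIV] pow mult by simp
  then show ?thesis
    by (subst poly_mapping_eq_sum_single) (rule sum)
qed

lemma coeffs_hom_eqI:
  assumes "unital_ring_hom g" "unital_ring_hom h"
    and "g sym1 = h sym1" "g sym2 = h sym2" "g (sym3_pow 1) = h (sym3_pow 1)"
    "g (sym3_pow (- 1)) = h (sym3_pow (- 1))"
  shows "g f = h f"
proof -
  interpret g: unital_ring_hom g by fact
  interpret h: unital_ring_hom h by fact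
  have s1: "sym1 ^ a = Poly_Mapping.single (a, 0, 0) 1" for a
    by (induction a) (simp_all add: sym1_def mult_single flip: single_one zero_prod_def)
  have s2: "sym2 ^ b = Poly_Mapping.single (0, b, 0) 1" for b
    by (induction b) (simp_all add: sym2_def mult_single flip: single_one zero_prod_def)
  have s3: "sym3_pow i ^ n = Poly_Mapping.single (0, 0, i * int n) 1" for i n
    by (induction n)
      (simp_all add: sym3_pow_def mult_single algebra_simps flip: single_one zero_prod_def)
  have s3': "Poly_Mapping.single (0, 0, c) 1 =
      (if c \<ge> 0 then sym3_pow 1 ^ nat c else sym3_pow (- 1) ^ nat (- c))" for c
    by (simp add: s3)
  have "Poly_Mapping.single (a, b, c) k = of_int k * (sym1 ^ a * sym2 ^ b *
      (if c \<ge> 0 then sym3_pow 1 ^ nat c else sym3_pow (- 1) ^ nat (- c)))" for a b c k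
    unfolding s3'[symmetric] s1 s2 single_of_int[symmetric] by (simp add: mult_single)
  then have "g (Poly_Mapping.single (a, b, c) k) = h (Poly_Mapping.single (a, b, c) k)" for a b c k
    using assms(3-) by simp
  then have "g (Poly_Mapping.single m k) = h (Poly_Mapping.single m k)" for m k
    by (cases m) simp
  then show ?thesis
    by (subst (1 2) poly_mapping_eq_sum_single) (simp add: g.hom_sum h.hom_sum)
qed


section \<open>The involution and the endomorphisms\<close>

lemma sym3_pow_add: "sym3_pow (i + j) = sym3_pow i * sym3_pow j"
  by (simp add: sym3_pow_def mult_single)

lemma sym3_pow_0: "sym3_pow 0 = 1"
  by (simp add: sym3_pow_def flip: single_one zero_prod_def)

lemma sym3_pow_inverse [simp]:
  "sym3_pow i * sym3_pow (- i) = 1" "sym3_pow (- i) * sym3_pow i = 1"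
  by (simp_all flip: sym3_pow_add add: sym3_pow_0)

lemma unital_ring_hom_star: "unital_ring_hom star"
  unfolding star_def by (rule unital_ring_hom_eval_coeffs) simp

interpretation star: unital_ring_hom star
  by (fact unital_ring_hom_star)

lemma star_generators:
  "star sym1 = sym2 * sym3_pow (- 1)" "star sym2 = sym1 * sym3_pow (- 1)"
  "star (sym3_pow i) = sym3_pow (- i)"
proof -
  have pow: "sym3_pow i ^ n = sym3_pow (i * int n)" for i n
    by (induction n) (simp_all add: sym3_pow_0 sym3_pow_add algebra_simps)
  have single: "star (Poly_Mapping.single (a, b, c) 1) = (sym2 * sym3_pow (- 1)) ^ a *
      (sym1 * sym3_pow (- 1)) ^ b *
      (if c \<ge> 0 then sym3_pow (- 1) ^ nat c else sym3_pow 1 ^ nat (- c))" for a b c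
    unfolding star_def by (simp add: unital_ring_hom_eval_coeffs(2))
  show "star sym1 = sym2 * sym3_pow (- 1)"
    by (subst sym1_def) (simp add: single)
  show "star sym2 = sym1 * sym3_pow (- 1)"
    by (subst sym2_def) (simp add: single)
  show "star (sym3_pow i) = sym3_pow (- i)"
    by (subst sym3_pow_def) (simp add: single pow)
qed

lemma star_star [simp]: "star (star a) = a"
proof (rule coeffs_hom_eqI)
  show "unital_ring_hom (\<lambda>a. star (star a))" "unital_ring_hom (\<lambda>a::coeffs. a)"
    by (auto intro: unital_ring_hom_comp unital_ring_hom_star simp: unital_ring_hom_def)
  have cancel: "x * sym3_pow (- 1) * sym3_pow 1 = x" for x
    by (simp add: mult.assoc)
  show "star (star sym1) = sym1" "star (star sym2) = sym2"
    "star (star (sym3_pow 1)) = sym3_pow 1" "star (star (sym3_pow (- 1))) = sym3_pow (- 1)"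
    by (simp_all add: star_generators cancel)
qed

lemma swap_var_swap_var [simp]: "swap_var (swap_var v) = v"
  by (cases v) simp_all

lemma unital_ring_hom_const_star: "unital_ring_hom (\<lambda>a. coeff_const (star a))"
  by (rule unital_ring_hom_comp[OF unital_ring_hom_coeff_const unital_ring_hom_star])

interpretation nu: unital_ring_hom nu
  unfolding nu_def by (rule unital_ring_hom_subst_poly[OF unital_ring_hom_const_star])

lemma nu_coeff_const [simp]: "nu (coeff_const a) = coeff_const (star a)"
  and nu_xvar [simp]: "nu (xvar v) = xvar (swap_var v)"
  unfolding nu_def by (simp_all add: unital_ring_hom_subst_poly[OF unital_ring_hom_const_star])

lemma nu_nu [simp]: "nu (nu f) = f"
  by (induction f rule: ring_R_induct) simp_all

lemma A_algebra_endo_iff: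
  "A_algebra_endo \<phi> \<longleftrightarrow> unital_ring_hom \<phi> \<and> (\<forall>a. \<phi> (coeff_const a) = coeff_const a)"
  unfolding A_algebra_endo_def unital_ring_hom_def by (metis coeff_const.hom_one)

lemma nu_endo_hom: "nu_endo \<phi> \<Longrightarrow> unital_ring_hom \<phi>"
  and nu_endo_const: "nu_endo \<phi> \<Longrightarrow> \<phi> (coeff_const a) = coeff_const a"
  and nu_endo_nu: "nu_endo \<phi> \<Longrightarrow> \<phi> (nu f) = nu (\<phi> f)"
  by (simp_all add: nu_endo_def A_algebra_endo_iff)

lemma nu_endo_images:
  assumes "nu_endo \<phi>"
  shows "images (\<phi> (xvar V1)) (\<phi> (xvar V3)) (\<phi> (xvar V5)) v = \<phi> (xvar v)"
  by (cases v) (simp_all add: nu_endo_nu[OF assms, symmetric])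

lemma nu_images: "nu (images P Q R v) = images P Q R (swap_var v)"
  by (cases v) simp_all

lemma unital_ring_hom_endo_of: "unital_ring_hom (endo_of P Q R)"
  and endo_of_const [simp]: "endo_of P Q R (coeff_const a) = coeff_const a"
  and endo_of_xvar [simp]: "endo_of P Q R (xvar v) = images P Q R v"
  unfolding endo_of_def by (simp_all add: unital_ring_hom_subst_poly[OF unital_ring_hom_coeff_const])

lemma nu_endo_endo_of: "nu_endo (endo_of P Q R)"
proof -
  interpret unital_ring_hom "endo_of P Q R"
    by (rule unital_ring_hom_endo_of)
  have "endo_of P Q R (nu f) = nu (endo_of P Q R f)" for f
    by (induction f rule: ring_R_induct) (simp_all add: nu_images)
  then show ?thesis
    by (simp add: nu_endo_def A_algebra_endo_iff unital_ring_hom_endo_of)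
qed

lemma nu_endo_eqI:
  assumes "nu_endo \<phi>" "nu_endo \<psi>"
    and "\<phi> (xvar V1) = \<psi> (xvar V1)" "\<phi> (xvar V3) = \<psi> (xvar V3)" "\<phi> (xvar V5) = \<psi> (xvar V5)"
  shows "\<phi> = \<psi>"
proof
  fix f
  interpret \<phi>: unital_ring_hom \<phi> using assms(1) by (rule nu_endo_hom)
  interpret \<psi>: unital_ring_hom \<psi> using assms(2) by (rule nu_endo_hom)
  have "\<phi> (xvar v) = \<psi> (xvar v)" for v
    using assms(3-) nu_endo_images[OF assms(1), of v] nu_endo_images[OF assms(2), of v] by simp
  then show "\<phi> f = \<psi> f"
    by (induction f rule: ring_R_induct) (simp_all add: nu_endo_const assms(1,2))
qed

text \<open>
  It suffices to check both composites on the variables \<open>x\<^sub>1, x\<^sub>3, x\<^sub>5\<close>, because a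
  \<open>\<nu>\<close>-endomorphism is determined by its triple.
\<close>

lemma nu_autoI_endo_of:
  fixes P Q R P' Q' R'
  defines "\<phi> \<equiv> endo_of P Q R" and "\<psi> \<equiv> endo_of P' Q' R'"
  assumes "\<phi> P' = xvar V1" "\<phi> Q' = xvar V3" "\<phi> R' = xvar V5"
    and "\<psi> P = xvar V1" "\<psi> Q = xvar V3" "\<psi> R = xvar V5"
  shows "nu_auto \<phi>"
proof -
  have *: "nu_endo \<phi>" "nu_endo \<psi>"
    by (simp_all add: \<phi>_def \<psi>_def nu_endo_endo_of)
  moreover have "\<phi> \<circ> \<psi> = id"
    using assms(3-5) by (intro nu_endo_eqI nu_endo_comp nu_endo_id *) (simp_all add: \<psi>_def)
  moreover have "\<psi> \<circ> \<phi> = id"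
    using assms(6-8) by (intro nu_endo_eqI nu_endo_comp nu_endo_id *) (simp_all add: \<phi>_def)
  ultimately show ?thesis
    unfolding nu_auto_def by blast
qed

interpretation endo_of: unital_ring_hom "endo_of P Q R" for P Q R
  by (rule unital_ring_hom_endo_of)

section \<open>The generators\<close>

definition Markov_gens :: "(ring_R \<Rightarrow> ring_R) set" where
  "Markov_gens = {Lambda_gen i j | i j. i \<in> {0, 1} \<and> j \<in> {0, 1}} \<union>
      {Sigma1_gen, Sigma2_gen, T1_gen, T2_gen} \<union> {M_gen i j | i j. True}"

lemma Markov_gens_simps:
  "i \<in> {0, 1} \<Longrightarrow> j \<in> {0, 1} \<Longrightarrow> Lambda_gen i j \<in> Markov_gens"
  "Sigma1_gen \<in> Markov_gens" "Sigma2_gen \<in> Markov_gens"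
  "T1_gen \<in> Markov_gens" "T2_gen \<in> Markov_gens" "M_gen k l \<in> Markov_gens"
  unfolding Markov_gens_def by auto

lemma neg_one_power_cancel: "(- 1) ^ i * ((- 1) ^ i * f) = (f :: ring_R)"
  by (simp add: mult.assoc[symmetric] flip: power_add mult_2)

lemma sym3_const_cancel:
  "coeff_const (sym3_pow i) * (coeff_const (sym3_pow (- i)) * f) = f"
  "coeff_const (sym3_pow (- i)) * (coeff_const (sym3_pow i) * f) = f"
  by (simp_all add: mult.assoc[symmetric] flip: coeff_const.hom_mult)

text \<open>
  The inverses of \<open>T\<^sub>1\<close> and \<open>T\<^sub>2\<close> are found by solving for the variables: for instance
  \<open>T\<^sub>1\<close> sends \<open>x\<^sub>3\<close> to \<open>x\<^sub>6 - x\<^sub>1 x\<^sub>3\<close> and \<open>x\<^sub>6\<close> to \<open>x\<^sub>3\<close>, so its inverse must send \<open>x\<^sub>3\<close> to \<open>x\<^sub>6\<close>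
  and \<open>x\<^sub>6\<close> to \<open>x\<^sub>3 - x\<^sub>2 x\<^sub>6\<close>.
\<close>

lemma nu_auto_generators:
  "nu_auto (Lambda_gen i j)" "nu_auto Sigma1_gen" "nu_auto Sigma2_gen"
  "nu_auto T1_gen" "nu_auto T2_gen" "nu_auto (M_gen k l)"
proof -
  show "nu_auto (Lambda_gen i j)"
    unfolding Lambda_gen_def
    by (rule nu_autoI_endo_of[where P' = "(- 1) ^ i * xvar V1"
          and Q' = "(- 1) ^ (i + j) * xvar V3" and R' = "(- 1) ^ j * xvar V5"])
      (simp_all add: neg_one_power_cancel)
  show "nu_auto Sigma1_gen"
    unfolding Sigma1_gen_def by (rule nu_autoI_endo_of) simp_all
  show "nu_auto Sigma2_gen"
    unfolding Sigma2_gen_def by (rule nu_autoI_endo_of) simp_all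
  show "nu_auto T1_gen"
    unfolding T1_gen_def
    by (rule nu_autoI_endo_of[where P' = "- xvar V2" and Q' = "xvar V6"
          and R' = "xvar V4 - xvar V1 * xvar V5"]) simp_all
  show "nu_auto T2_gen"
    unfolding T2_gen_def
    by (rule nu_autoI_endo_of[where P' = "xvar V4" and Q' = "xvar V2 - xvar V3 * xvar V5"
          and R' = "- xvar V6"]) simp_all
  show "nu_auto (M_gen k l)"
    unfolding M_gen_def
    by (rule nu_autoI_endo_of[where P' = "coeff_const (sym3_pow k) * xvar V1"
          and Q' = "coeff_const (sym3_pow (- (k + l))) * xvar V3"
          and R' = "coeff_const (sym3_pow l) * xvar V5"])
      (simp_all only: endo_of.hom_mult endo_of_const endo_of_xvar images.simps sym3_const_cancel)
qed

lemma endo_of_H_poly: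
  "endo_of P Q R H_poly = P * nu P + Q * nu Q + R * nu R - P * Q * R"
  by (simp add: H_poly_def)

lemma H_poly_generators:
  "Lambda_gen i j H_poly = H_poly" "Sigma1_gen H_poly = H_poly" "Sigma2_gen H_poly = H_poly"
  "T1_gen H_poly = H_poly" "T2_gen H_poly = H_poly" "M_gen k l H_poly = H_poly"
proof -
  have sq: "e * a * (e * b) = a * b" if "e * e = 1" for a b e :: ring_R
  proof -
    have "e * a * (e * b) = e * e * (a * b)" by (simp only: mult_ac)
    then show ?thesis by (simp add: that)
  qed
  have tri: "e * a * (f * b) * (g * c) = a * b * c" if "e * f * g = 1" for a b c e f g :: ring_R
  proof -
    have "e * a * (f * b) * (g * c) = e * f * g * (a * b * c)" by (simp only: mult_ac)
    then show ?thesis by (simp add: that)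
  qed
  have "(- 1 :: ring_R) ^ n * (- 1) ^ n = 1" for n
    by (simp flip: power_add mult_2)
  note sign = this
  have "(- 1 :: ring_R) ^ i * (- 1) ^ (i + j) * (- 1) ^ j =
      ((- 1) ^ i * (- 1) ^ i) * ((- 1) ^ j * (- 1) ^ j)"
    by (simp only: power_add mult_ac)
  then have "(- 1 :: ring_R) ^ i * (- 1) ^ (i + j) * (- 1) ^ j = 1"
    by (simp only: sign) simp
  with sign show "Lambda_gen i j H_poly = H_poly"
    unfolding Lambda_gen_def endo_of_H_poly
    by (simp only: nu.hom_mult nu.hom_power nu.hom_uminus nu.hom_one nu_xvar swap_var.simps sq tri)
      (simp add: H_poly_def)
  show "Sigma1_gen H_poly = H_poly" "Sigma2_gen H_poly = H_poly"
    unfolding Sigma1_gen_def Sigma2_gen_def endo_of_H_poly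
    by (simp_all add: H_poly_def algebra_simps)
  show "T1_gen H_poly = H_poly" "T2_gen H_poly = H_poly"
    unfolding T1_gen_def T2_gen_def endo_of_H_poly
    by (simp_all add: H_poly_def algebra_simps)
  have sq': "coeff_const (sym3_pow k) * a * (coeff_const (sym3_pow (- k)) * b) = a * b" for k a b
    using sym3_const_cancel(1)[of k "a * b"] by (simp only: mult_ac)
  have sq'': "coeff_const (sym3_pow (- k)) * a * (coeff_const (sym3_pow k) * b) = a * b" for k a b
    using sq'[of "- k" a b] by simp
  have "coeff_const (sym3_pow (- k)) * coeff_const (sym3_pow (k + l)) * coeff_const (sym3_pow (- l)) = 1"
    by (simp flip: coeff_const.hom_mult sym3_pow_add add: sym3_pow_0)
  then show "M_gen k l H_poly = H_poly"
    unfolding M_gen_def endo_of_H_poly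
    by (simp only: nu.hom_mult nu_coeff_const star_generators nu_xvar swap_var.simps sq' sq'' tri minus_minus)
      (simp add: H_poly_def)
qed

lemma subgroup_G_Hor: "subgroup G_Hor nu_auto_group"
proof (rule group.subgroupI[OF group_nu_auto_group])
  show "G_Hor \<subseteq> carrier nu_auto_group"
    by (auto simp: G_Hor_def nu_auto_group_def)
  show "G_Hor \<noteq> {}"
    using H_poly_generators(2) nu_auto_generators(2) by (auto simp: G_Hor_def)
  show "\<phi> \<otimes>\<^bsub>nu_auto_group\<^esub> \<psi> \<in> G_Hor" if "\<phi> \<in> G_Hor" "\<psi> \<in> G_Hor" for \<phi> \<psi>
    using that by (simp add: G_Hor_def nu_auto_group_def nu_auto_comp)
  show "inv\<^bsub>nu_auto_group\<^esub> \<phi> \<in> G_Hor" if "\<phi> \<in> G_Hor" for \<phi>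
  proof -
    interpret group nu_auto_group by (rule group_nu_auto_group)
    have \<phi>: "\<phi> \<in> carrier nu_auto_group" "\<phi> H_poly = H_poly"
      using that by (auto simp: G_Hor_def nu_auto_group_def)
    have "inv\<^bsub>nu_auto_group\<^esub> \<phi> \<circ> \<phi> = id"
      using l_inv[OF \<phi>(1)] by (simp add: nu_auto_group_def)
    then have "(inv\<^bsub>nu_auto_group\<^esub> \<phi>) H_poly = H_poly"
      using \<phi>(2) by (metis comp_apply id_apply)
    then show ?thesis
      using inv_closed[OF \<phi>(1)] by (simp add: G_Hor_def nu_auto_group_def)
  qed
qed

lemma Markov_gens_subset: "Markov_gens \<subseteq> G_Hor"
  by (auto simp: Markov_gens_def G_Hor_def nu_auto_generators H_poly_generators)

lemma Gamma_M_aut_eq: "Gamma_M_aut = generate nu_auto_group Markov_gens"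
  unfolding Gamma_M_aut_def Markov_gens_def ..

lemma Gamma_M_aut_subset_G_Hor: "Gamma_M_aut \<subseteq> G_Hor"
  unfolding Gamma_M_aut_eq
  by (rule group.generate_subgroup_incl[OF group_nu_auto_group Markov_gens_subset subgroup_G_Hor])

lemma subgroup_Gamma_M_aut: "subgroup Gamma_M_aut nu_auto_group"
  unfolding Gamma_M_aut_eq using Markov_gens_subset
  by (intro group.generate_is_subgroup group_nu_auto_group) (auto simp: G_Hor_def nu_auto_group_def)

lemma generators_in_Gamma_M_aut: "Markov_gens \<subseteq> Gamma_M_aut"
  unfolding Gamma_M_aut_eq by (blast intro: generate.incl)

lemma comp_in_Gamma_M_aut: "\<phi> \<in> Gamma_M_aut \<Longrightarrow> \<psi> \<in> Gamma_M_aut \<Longrightarrow> \<phi> \<circ> \<psi> \<in> Gamma_M_aut"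
  using subgroup.m_closed[OF subgroup_Gamma_M_aut] by (simp add: nu_auto_group_def)

text \<open>
  The descent establishes that \<open>\<phi> \<circ> \<psi>\<close> is in the group, for a suitable generator \<open>\<psi>\<close>; this
  brings the conclusion back to \<open>\<phi>\<close>.
\<close>

lemma Gamma_M_aut_cancel_right:
  assumes "\<phi> \<circ> \<psi> \<in> Gamma_M_aut" "\<psi> \<in> Gamma_M_aut"
  shows "\<phi> \<in> Gamma_M_aut"
proof -
  interpret group nu_auto_group by (rule group_nu_auto_group)
  have "\<psi> \<in> carrier nu_auto_group"
    using assms(2) subgroup.subset[OF subgroup_Gamma_M_aut] by blast
  then have "\<psi> \<circ> inv\<^bsub>nu_auto_group\<^esub> \<psi> = id"
    using r_inv by (simp add: nu_auto_group_def)
  then have "(\<phi> \<circ> \<psi>) \<circ> inv\<^bsub>nu_auto_group\<^esub> \<psi> = \<phi>"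
    by (simp add: comp_assoc)
  then show ?thesis
    using comp_in_Gamma_M_aut[OF assms(1) subgroup.m_inv_closed[OF subgroup_Gamma_M_aut assms(2)]]
    by simp
qed


section \<open>Jacobian matrices\<close>

lemma unital_ring_hom_spec_coeffs:
  assumes "z1 \<noteq> 0" "z2 \<noteq> 0" "z3 \<noteq> 0"
  shows "unital_ring_hom (spec_coeffs (z1, z2, z3))"
  unfolding spec_coeffs_def split_conv
  by (rule unital_ring_hom_eval_coeffs) (simp add: assms field_simps)

locale specialization =
  fixes p :: "complex \<times> complex \<times> complex"
  assumes spec_hom: "unital_ring_hom (spec_coeffs p)"
begin

definition ev :: "complex ^ var \<Rightarrow> ring_R \<Rightarrow> complex" where
  "ev q = subst_poly (spec_coeffs p) (\<lambda>v. q $ v)"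

sublocale ev: unital_ring_hom "ev q" for q
  unfolding ev_def by (rule unital_ring_hom_subst_poly[OF spec_hom])

lemma ev_const [simp]: "ev q (coeff_const a) = spec_coeffs p a"
  and ev_xvar [simp]: "ev q (xvar v) = q $ v"
  unfolding ev_def by (simp_all add: unital_ring_hom_subst_poly[OF spec_hom])

definition upd :: "complex ^ var \<Rightarrow> var \<Rightarrow> complex \<Rightarrow> complex ^ var" where
  "upd q j t = (\<chi> k. if k = j then t else q $ k)"

lemma upd_same [simp]: "upd q j (q $ j) = q"
  by (simp add: upd_def vec_eq_iff)

definition pderiv_at :: "complex ^ var \<Rightarrow> var \<Rightarrow> ring_R \<Rightarrow> complex" where
  "pderiv_at q j f = deriv (\<lambda>t. ev (upd q j t) f) (q $ j)"

lemma ev_differentiable: "(\<lambda>t. ev (upd q j t) f) field_differentiable at t"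
proof (induction f rule: ring_R_induct)
  case (var v)
  then show ?case by (cases "v = j") (simp_all add: upd_def)
qed (simp_all add: field_differentiable_add field_differentiable_mult)

lemma pderiv_at_const [simp]: "pderiv_at q j (coeff_const a) = 0"
  by (simp add: pderiv_at_def)

lemma pderiv_at_xvar [simp]: "pderiv_at q j (xvar v) = (if v = j then 1 else 0)"
  by (simp add: pderiv_at_def upd_def)

lemma pderiv_at_add: "pderiv_at q j (f + g) = pderiv_at q j f + pderiv_at q j g"
  unfolding pderiv_at_def by (simp add: deriv_add ev_differentiable)

lemma pderiv_at_mult: "pderiv_at q j (f * g) = ev q f * pderiv_at q j g + pderiv_at q j f * ev q g"
  unfolding pderiv_at_def by (simp add: deriv_mult ev_differentiable)

lemma spec_map_nth:
  assumes "nu_endo \<phi>"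
  shows "spec_map \<phi> p q $ v = ev q (\<phi> (xvar v))"
  by (simp add: spec_map_def nu_endo_images[OF assms] ev_def)

lemma ev_spec_map:
  assumes "nu_endo \<phi>"
  shows "ev (spec_map \<phi> p q) f = ev q (\<phi> f)"
proof -
  interpret unital_ring_hom \<phi> using assms by (rule nu_endo_hom)
  show ?thesis
    by (induction f rule: ring_R_induct) (simp_all add: nu_endo_const assms spec_map_nth)
qed

text \<open>
  Both sides, as functions of \<open>f\<close>, are derivations with respect to the homomorphism
  \<open>f \<mapsto> ev q (\<phi> f)\<close> which vanish on constants, so agreement on the variables is enough.
\<close>

lemma pderiv_at_chain_rule:
  assumes "nu_endo \<phi>"
  shows "pderiv_at q j (\<phi> f) =
    (\<Sum>i\<in>UNIV. pderiv_at (spec_map \<phi> p q) i f * pderiv_at q j (\<phi> (xvar i)))"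
proof -
  interpret unital_ring_hom \<phi> using assms by (rule nu_endo_hom)
  show ?thesis
  proof (induction f rule: ring_R_induct)
    case (var v)
    have "(\<Sum>i\<in>UNIV. pderiv_at (spec_map \<phi> p q) i (xvar v) * pderiv_at q j (\<phi> (xvar i))) =
        (\<Sum>i\<in>UNIV. if i = v then pderiv_at q j (\<phi> (xvar i)) else 0)"
      by (rule sum.cong) auto
    then show ?case by simp
  next
    case (mult f g)
    then show ?case
      by (simp add: pderiv_at_mult ev_spec_map[OF assms] sum.distrib distrib_right sum_distrib_left
          mult.assoc) (simp add: sum_distrib_left sum_distrib_right mult_ac)
  qed (simp_all add: nu_endo_const[OF assms] pderiv_at_add sum.distrib distrib_right)
qed

lemma jacobian_nth:
  assumes "nu_endo \<phi>"
  shows "complex_jacobian (spec_map \<phi> p) q $ i $ j = pderiv_at q j (\<phi> (xvar i))"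
  by (simp add: complex_jacobian_def spec_map_nth assms pderiv_at_def upd_def)

text \<open>
  The order of the factors is reversed because \<open>\<phi> \<mapsto> spec_map \<phi> p\<close> is contravariant.
\<close>

lemma jacobian_comp:
  assumes "nu_endo \<phi>" "nu_endo \<psi>"
  shows "complex_jacobian (spec_map (\<phi> \<circ> \<psi>) p) q =
    complex_jacobian (spec_map \<psi> p) (spec_map \<phi> p q) ** complex_jacobian (spec_map \<phi> p) q"
  using pderiv_at_chain_rule[OF assms(1), of q _ "\<psi> (xvar _)"]
  by (simp add: vec_eq_iff matrix_matrix_mult_def jacobian_nth assms nu_endo_comp)

lemma jacobian_id: "complex_jacobian (spec_map id p) q = mat 1"
  by (simp add: vec_eq_iff jacobian_nth nu_endo_id mat_def)

lemma invertible_jacobian: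
  assumes "nu_auto \<phi>"
  shows "invertible (complex_jacobian (spec_map \<phi> p) q)"
proof -
  from assms obtain \<psi> where *: "nu_endo \<phi>" "nu_endo \<psi>" "\<phi> \<circ> \<psi> = id"
    unfolding nu_auto_def by blast
  then have "complex_jacobian (spec_map \<psi> p) (spec_map \<phi> p q) ** complex_jacobian (spec_map \<phi> p) q
      = mat 1"
    by (simp add: jacobian_comp[symmetric] jacobian_id)
  then show ?thesis
    using matrix_left_right_inverse unfolding invertible_def by blast
qed

end

lemma maximal_rankE:
  assumes "maximal_rank \<phi>"
  obtains p q where "specialization p" "invertible (complex_jacobian (spec_map \<phi> p) q)"
  using assms unital_ring_hom_spec_coeffs unfolding maximal_rank_def specialization_def by blast

lemma maximal_rank_nu_auto:
  assumes "nu_auto \<phi>"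
  shows "maximal_rank \<phi>"
proof -
  interpret specialization "(1, 1, 1)"
    by (intro specialization.intro unital_ring_hom_spec_coeffs) simp_all
  have "invertible (complex_jacobian (spec_map \<phi> (1, 1, 1)) 0)"
    by (rule invertible_jacobian[OF assms])
  then show ?thesis
    unfolding maximal_rank_def by (intro exI[of _ 1] exI[of _ 0]) simp
qed

lemma G_Hor_subset_Gamma_max: "G_Hor \<subseteq> Gamma_max"
  using maximal_rank_nu_auto by (auto simp: G_Hor_def Gamma_max_def) (simp add: nu_auto_def)

text \<open>
  Maximal rank survives at the same point \<open>q\<close>, since the Jacobian matrix of the automorphism is
  invertible wherever \<open>\<phi>\<close> sends \<open>q\<close>.
\<close>

lemma Gamma_max_comp_G_Hor:
  assumes \<phi>: "\<phi> \<in> Gamma_max" and \<psi>: "\<psi> \<in> G_Hor"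
  shows "\<phi> \<circ> \<psi> \<in> Gamma_max"
proof -
  have endo: "nu_endo \<phi>" "nu_endo \<psi>" "nu_auto \<psi>" and max: "maximal_rank \<phi>"
    using \<phi> \<psi> by (auto simp: Gamma_max_def G_Hor_def nu_auto_def)
  from max obtain z1 z2 z3 q where z: "z1 \<noteq> 0" "z2 \<noteq> 0" "z3 \<noteq> 0"
    and inv: "invertible (complex_jacobian (spec_map \<phi> (z1, z2, z3)) q)"
    unfolding maximal_rank_def by blast
  interpret specialization "(z1, z2, z3)"
    by (intro specialization.intro unital_ring_hom_spec_coeffs z)
  have "invertible (complex_jacobian (spec_map (\<phi> \<circ> \<psi>) (z1, z2, z3)) q)"
    unfolding jacobian_comp[OF endo(1,2)] by (intro invertible_mult invertible_jacobian inv endo)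
  then have "maximal_rank (\<phi> \<circ> \<psi>)"
    using z unfolding maximal_rank_def by blast
  then show ?thesis
    using \<phi> \<psi> by (auto simp: Gamma_max_def G_Hor_def nu_auto_def intro: nu_endo_comp)
qed

text \<open>
  A constant component would give a zero row in the Jacobian matrix.
\<close>

lemma Gamma_max_not_const:
  assumes "\<phi> \<in> Gamma_max"
  shows "\<phi> (xvar v) \<noteq> coeff_const a"
proof
  assume const: "\<phi> (xvar v) = coeff_const a"
  obtain p q where p: "specialization p" and inv: "invertible (complex_jacobian (spec_map \<phi> p) q)"
    using assms by (auto simp: Gamma_max_def elim: maximal_rankE)
  interpret specialization p by (fact p)
  let ?J = "complex_jacobian (spec_map \<phi> p) q"
  obtain B where B: "?J ** B = mat 1"
    using inv unfolding invertible_def by blast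
  have "?J $ v $ j = 0" for j
    using assms by (simp add: Gamma_max_def jacobian_nth const)
  then have "(?J ** B) $ v $ v = 0"
    by (simp add: matrix_matrix_mult_def)
  with B show False
    by (simp add: mat_def)
qed


section \<open>Zero divisors and units\<close>

text \<open>
  An injective additive map \<open>e\<close> into an ordered group orders the keys. The sum of the two maximal
  keys then arises in only one way, so the leading coefficient of a product is the product of the
  leading coefficients. An explicit \<open>e\<close> serves better than a type class here: products of types are
  ordered componentwise, which is not a linear order, and negating \<open>e\<close> gives the statement for minimal keys.
\<close>

lemma monoid_ring_leading_key:
  fixes f g :: "'k::comm_monoid_add \<Rightarrow>\<^sub>0 'a::comm_ring_1" and e :: "'k \<Rightarrow> 'o::linordered_ab_group_add"
  assumes "inj e" and e_add: "\<And>k l. e (k + l) = e k + e l" and "f \<noteq> 0" "g \<noteq> 0"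
  obtains k l where "k \<in> Poly_Mapping.keys f" "l \<in> Poly_Mapping.keys g"
    "\<And>k'. k' \<in> Poly_Mapping.keys f \<Longrightarrow> e k' \<le> e k" "\<And>l'. l' \<in> Poly_Mapping.keys g \<Longrightarrow> e l' \<le> e l"
    "Poly_Mapping.lookup (f * g) (k + l) = Poly_Mapping.lookup f k * Poly_Mapping.lookup g l"
proof -
  have top: "\<exists>k\<in>Poly_Mapping.keys h. \<forall>k'\<in>Poly_Mapping.keys h. e k' \<le> e k"
    if "h \<noteq> 0" for h :: "'k \<Rightarrow>\<^sub>0 'a"
  proof -
    have ne: "Poly_Mapping.keys h \<noteq> {}"
      using that by (metis empty_iff in_keys_iff lookup_zero poly_mapping_eqI)
    then have "Max (e ` Poly_Mapping.keys h) \<in> e ` Poly_Mapping.keys h"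
      by (intro Max_in) simp_all
    then obtain k where "k \<in> Poly_Mapping.keys h" "Max (e ` Poly_Mapping.keys h) = e k"
      by blast
    then show ?thesis
      by (metis Max_ge finite_imageI finite_keys imageI)
  qed
  obtain k l where k: "k \<in> Poly_Mapping.keys f" "\<And>k'. k' \<in> Poly_Mapping.keys f \<Longrightarrow> e k' \<le> e k"
    and l: "l \<in> Poly_Mapping.keys g" "\<And>l'. l' \<in> Poly_Mapping.keys g \<Longrightarrow> e l' \<le> e l"
    using top[OF \<open>f \<noteq> 0\<close>] top[OF \<open>g \<noteq> 0\<close>] by blast
  let ?c = "\<lambda>k' l'. Poly_Mapping.lookup f k' * Poly_Mapping.lookup g l'"
  have uniq: "k' + l' = k + l \<longleftrightarrow> k' = k \<and> l' = l"
    if "k' \<in> Poly_Mapping.keys f" "l' \<in> Poly_Mapping.keys g" for k' l'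
  proof
    assume "k' + l' = k + l"
    then have "e k' + e l' = e k + e l"
      by (metis e_add)
    then have "e k' = e k" "e l' = e l"
      using k(2)[OF that(1)] l(2)[OF that(2)]
      by (metis add_less_le_mono add_le_less_mono order_less_le)+
    then show "k' = k \<and> l' = l"
      using \<open>inj e\<close> by (simp add: inj_eq)
  qed simp
  have "Poly_Mapping.lookup (f * g) (k + l) =
      (\<Sum>k'\<in>Poly_Mapping.keys f. \<Sum>l'\<in>Poly_Mapping.keys g. ?c k' l' when k' + l' = k + l)"
    unfolding poly_mapping_times_eq_sum[of f g] by (simp add: lookup_sum lookup_single)
  also have "\<dots> = (\<Sum>k'\<in>Poly_Mapping.keys f. \<Sum>l'\<in>Poly_Mapping.keys g.
      if l' = l then if k' = k then ?c k' l' else 0 else 0)"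
    by (intro sum.cong refl) (simp add: uniq when_def)
  also have "\<dots> = ?c k l"
    using k(1) l(1) by simp
  finally have "Poly_Mapping.lookup (f * g) (k + l) = ?c k l" .
  then show ?thesis
    by (rule that[of k l, rotated 4]) (fact k l)+
qed

lemma monoid_ring_no_zero_divisors:
  fixes f g :: "'k::comm_monoid_add \<Rightarrow>\<^sub>0 'a::comm_ring_1" and e :: "'k \<Rightarrow> 'o::linordered_ab_group_add"
  assumes e: "inj e" "\<And>k l. e (k + l) = e k + e l"
    and dom: "\<And>a b :: 'a. a * b = 0 \<Longrightarrow> a = 0 \<or> b = 0" and "f * g = 0"
  shows "f = 0 \<or> g = 0"
proof (rule ccontr)
  assume "\<not> (f = 0 \<or> g = 0)"
  then have "f \<noteq> 0" "g \<noteq> 0" by auto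
  then obtain k l where "k \<in> Poly_Mapping.keys f" "l \<in> Poly_Mapping.keys g"
    "Poly_Mapping.lookup (f * g) (k + l) = Poly_Mapping.lookup f k * Poly_Mapping.lookup g l"
    using monoid_ring_leading_key[OF e] by metis
  then show False
    using dom \<open>f * g = 0\<close> by (metis in_keys_iff lookup_zero)
qed

text \<open>
  The lexicographic order of \<^typ>\<open>nat \<Rightarrow>\<^sub>0 int\<close> is a linear group order; the positions 1, 2, 3 of
  the code hold the three exponents.
\<close>

definition coeff_key :: "nat \<times> nat \<times> int \<Rightarrow> nat \<Rightarrow>\<^sub>0 int" where
  "coeff_key = (\<lambda>(a, b, c). Poly_Mapping.single 1 (int a) + Poly_Mapping.single 2 (int b) +
     Poly_Mapping.single 3 c)"

lemma coeff_key_add: "coeff_key (k + l) = coeff_key k + coeff_key l"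
  by (cases k; cases l) (simp add: coeff_key_def single_add algebra_simps)

lemma inj_coeff_key: "inj coeff_key"
proof (rule injI)
  fix k l assume "coeff_key k = coeff_key l"
  then have "Poly_Mapping.lookup (coeff_key k) i = Poly_Mapping.lookup (coeff_key l) i" for i
    by simp
  from this[of 1] this[of 2] this[of 3] show "k = l"
    by (cases k; cases l) (simp add: coeff_key_def lookup_add lookup_single when_def)
qed

lemma coeffs_no_zero_divisors: "a * b = 0 \<Longrightarrow> a = 0 \<or> b = 0" for a b :: coeffs
  by (rule monoid_ring_no_zero_divisors[OF inj_coeff_key coeff_key_add]) simp_all

lemma ring_R_no_zero_divisors:
  fixes f g :: ring_R
  assumes "f * g = 0"
  shows "f = 0 \<or> g = 0"
proof -
  obtain idx :: "var \<Rightarrow> nat" where idx: "inj idx"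
    using finite_imp_inj_to_nat_seg[OF finite_class.finite_UNIV] by metis
  define e :: "(var \<Rightarrow>\<^sub>0 nat) \<Rightarrow> nat \<Rightarrow>\<^sub>0 int" where
    "e m = (\<Sum>v\<in>UNIV. Poly_Mapping.single (idx v) (int (Poly_Mapping.lookup m v)))" for m
  have "Poly_Mapping.lookup (e m) (idx v) = int (Poly_Mapping.lookup m v)" for m v
    by (simp add: e_def lookup_sum lookup_single when_def inj_eq[OF idx])
  then have "inj e"
    by (intro injI poly_mapping_eqI) (metis of_nat_eq_iff)
  moreover have "e (k + l) = e k + e l" for k l
    by (simp add: e_def lookup_add single_add sum.distrib)
  ultimately show ?thesis
    by (rule monoid_ring_no_zero_divisors) (use coeffs_no_zero_divisors assms in auto)
qed

text \<open>
  If \<open>a b = 1\<close>, then the maximal keys of \<open>a\<close> and \<open>b\<close> add up to 0, and so do the minimal ones. Hence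
  the maximal and the minimal key of \<open>a\<close> agree and \<open>a\<close> is a monomial. Its exponents of \<open>s\<^sub>1\<close> and
  \<open>s\<^sub>2\<close> vanish since they are natural numbers with an additive inverse.
\<close>

lemma coeffs_unit:
  fixes a b :: coeffs
  assumes "a * b = 1"
  obtains i k where "a = (- 1) ^ i * sym3_pow k" "i \<in> {0, 1}"
proof -
  have "a \<noteq> 0" "b \<noteq> 0"
    using assms by auto
  have zero: "k + l = 0 \<and> Poly_Mapping.lookup a k * Poly_Mapping.lookup b l = 1"
    if "k \<in> Poly_Mapping.keys a" "l \<in> Poly_Mapping.keys b"
      "Poly_Mapping.lookup (a * b) (k + l) = Poly_Mapping.lookup a k * Poly_Mapping.lookup b l" for k l
    using that by (cases "k + l = 0") (auto simp: assms lookup_one in_keys_iff)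
  obtain k l where max: "k \<in> Poly_Mapping.keys a" "l \<in> Poly_Mapping.keys b"
    "\<And>k'. k' \<in> Poly_Mapping.keys a \<Longrightarrow> coeff_key k' \<le> coeff_key k"
    "\<And>l'. l' \<in> Poly_Mapping.keys b \<Longrightarrow> coeff_key l' \<le> coeff_key l"
    and kl: "k + l = 0" "Poly_Mapping.lookup a k * Poly_Mapping.lookup b l = 1"
    using monoid_ring_leading_key[OF inj_coeff_key coeff_key_add \<open>a \<noteq> 0\<close> \<open>b \<noteq> 0\<close>] zero by metis
  have "inj (\<lambda>k. - coeff_key k)"
    using inj_coeff_key by (auto simp: inj_def)
  moreover have "- coeff_key (k + l) = - coeff_key k + - coeff_key l" for k l
    by (simp add: coeff_key_add)
  ultimately obtain k' l' where min: "k' \<in> Poly_Mapping.keys a" "l' \<in> Poly_Mapping.keys b"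
    "\<And>k''. k'' \<in> Poly_Mapping.keys a \<Longrightarrow> - coeff_key k'' \<le> - coeff_key k'" and kl': "k' + l' = 0"
    using monoid_ring_leading_key[of "\<lambda>k. - coeff_key k", OF _ _ \<open>a \<noteq> 0\<close> \<open>b \<noteq> 0\<close>] zero by metis
  have "coeff_key k + coeff_key l = coeff_key k' + coeff_key l'"
    by (simp flip: coeff_key_add add: kl kl')
  then have "coeff_key k' = coeff_key k"
    using max(3)[OF min(1)] max(4)[OF min(2)] by (metis add_less_le_mono order_less_le)
  then have keys: "k'' = k" if "k'' \<in> Poly_Mapping.keys a" for k''
    using max(3)[OF that] min(3)[OF that] inj_coeff_key by (metis antisym injD neg_le_iff_le)
  obtain c where c: "k = (0, 0, c)"
    using kl(1) by (cases k; cases l) (auto simp: zero_prod_def)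
  have a: "a = Poly_Mapping.single k (Poly_Mapping.lookup a k)"
    using keys by (intro poly_mapping_eqI) (auto simp: lookup_single when_def in_keys_iff)
  have "Poly_Mapping.lookup a k = 1 \<or> Poly_Mapping.lookup a k = - 1"
    using kl(2) zmult_eq_1_iff by auto
  then have "a = sym3_pow c \<or> a = - sym3_pow c"
    using a unfolding c sym3_pow_def by (metis single_uminus)
  then show ?thesis
    using that[of 0 c] that[of 1 c] by auto
qed

section \<open>The total degree\<close>

text \<open>
  The substitution \<open>x\<^sub>v \<mapsto> t x\<^sub>v\<close>, as a polynomial in \<open>t\<close> over \<open>\<R>\<close>. Its coefficients are the
  homogeneous components, its degree is the total degree and its leading coefficient is the leading
  form, and being a ring homomorphism it makes all of these compatible with products.
\<close>

definition homog :: "ring_R \<Rightarrow> ring_R poly" where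
  "homog = subst_poly (\<lambda>a. [:coeff_const a:]) (\<lambda>v. [:0, xvar v:])"

lemma unital_ring_hom_pCons_const: "unital_ring_hom (\<lambda>a. [:coeff_const a:])"
  by standard (simp_all add: one_pCons)

interpretation homog: unital_ring_hom homog
  unfolding homog_def by (rule unital_ring_hom_subst_poly[OF unital_ring_hom_pCons_const])

lemma homog_const [simp]: "homog (coeff_const a) = [:coeff_const a:]"
  and homog_xvar [simp]: "homog (xvar v) = [:0, xvar v:]"
  unfolding homog_def by (simp_all add: unital_ring_hom_subst_poly[OF unital_ring_hom_pCons_const])

abbreviation tdeg :: "ring_R \<Rightarrow> nat" where
  "tdeg f \<equiv> degree (homog f)"

lemma poly_homog_1 [simp]: "poly (homog f) 1 = f"
  by (induction f rule: ring_R_induct) simp_all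

lemma coeff_homog_nu: "coeff (homog (nu f)) n = nu (coeff (homog f) n)"
proof (induction f arbitrary: n rule: ring_R_induct)
  case (const a)
  then show ?case by (cases n) simp_all
next
  case (var v)
  then show ?case by (cases n) (simp_all add: coeff_pCons split: nat.split)
next
  case (mult f g)
  then show ?case by (simp add: coeff_mult nu.hom_sum)
qed simp

lemma nu_eq_0_iff [simp]: "nu f = 0 \<longleftrightarrow> f = 0"
  by (metis nu.hom_zero nu_nu)

lemma tdeg_nu [simp]: "tdeg (nu f) = tdeg f"
proof -
  have "tdeg (nu f) \<le> tdeg f" for f
    by (rule degree_le) (simp add: coeff_homog_nu coeff_eq_0)
  from this[of f] this[of "nu f"] show ?thesis by simp
qed

lemma coeff_homog_0: "\<exists>a. coeff (homog f) 0 = coeff_const a"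
proof (induction f rule: ring_R_induct)
  case (var v)
  show ?case by (auto intro: exI[of _ 0])
qed (auto simp: coeff_mult_0 simp flip: coeff_const.hom_add coeff_const.hom_mult)

lemma coeff_homog_1: "\<exists>a. coeff (homog f) 1 = (\<Sum>v\<in>UNIV. coeff_const (a v) * xvar v)"
proof (induction f rule: ring_R_induct)
  case (const a)
  show ?case by (rule exI[of _ "\<lambda>_. 0"]) simp
next
  case (var v)
  have "(\<Sum>w\<in>UNIV. coeff_const (if w = v then 1 else 0) * xvar w) =
      (\<Sum>w\<in>UNIV. if w = v then xvar w else 0)"
    by (rule sum.cong) auto
  then show ?case by (intro exI[of _ "\<lambda>w. if w = v then 1 else 0"]) simp
next
  case (add f g)
  then obtain a b where "coeff (homog f) 1 = (\<Sum>v\<in>UNIV. coeff_const (a v) * xvar v)"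
    "coeff (homog g) 1 = (\<Sum>v\<in>UNIV. coeff_const (b v) * xvar v)" by blast
  then show ?case
    by (intro exI[of _ "\<lambda>v. a v + b v"]) (simp add: distrib_right sum.distrib)
next
  case (mult f g)
  then obtain a b where *: "coeff (homog f) 1 = (\<Sum>v\<in>UNIV. coeff_const (a v) * xvar v)"
    "coeff (homog g) 1 = (\<Sum>v\<in>UNIV. coeff_const (b v) * xvar v)" by blast
  obtain a0 b0 where **: "coeff (homog f) 0 = coeff_const a0" "coeff (homog g) 0 = coeff_const b0"
    using coeff_homog_0 by blast
  have "coeff (homog (f * g)) 1 = coeff_const a0 * coeff (homog g) 1 + coeff_const b0 * coeff (homog f) 1"
    by (simp add: coeff_mult ** mult.commute)
  then show ?case
    unfolding * by (intro exI[of _ "\<lambda>v. a0 * b v + b0 * a v"])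
      (simp add: distrib_right sum.distrib sum_distrib_left mult.assoc)
qed

definition lin :: "ring_R \<Rightarrow> ring_R" where
  "lin f = coeff (homog f) 1"

lemma tdeg_0_const:
  assumes "tdeg f = 0"
  shows "\<exists>a. f = coeff_const a"
proof -
  obtain b where b: "homog f = [:b:]"
    using assms by (rule degree_eq_zeroE)
  then have "f = coeff (homog f) 0"
    using poly_homog_1[of f] by simp
  then show ?thesis
    using coeff_homog_0[of f] by metis
qed

lemma homog_tdeg_1:
  assumes "tdeg f = 1"
  obtains a where "homog f = [:coeff_const a, lin f:]" "f = coeff_const a + lin f"
proof -
  obtain a where a: "coeff (homog f) 0 = coeff_const a"
    using coeff_homog_0 by blast
  have "homog f = [:coeff (homog f) 0, coeff (homog f) 1:]"
    by (rule poly_eqI) (auto simp: coeff_pCons coeff_eq_0 assms split: nat.split)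
  with a obtain L where L: "homog f = [:coeff_const a, L:]"
    by metis
  then have "f = coeff_const a + L"
    using poly_homog_1[of f] by simp
  with L show ?thesis
    by (intro that) (simp_all add: lin_def)
qed

lemma lead_coeff_nonzero: "tdeg f > 0 \<Longrightarrow> lead_coeff (homog f) \<noteq> 0"
  by (metis degree_0 leading_coeff_0_iff less_irrefl)

lemma homog_H_poly:
  "homog H_poly = [:0, 0, xvar V1 * xvar V2 + xvar V3 * xvar V4 + xvar V5 * xvar V6,
     - (xvar V1 * xvar V3 * xvar V5):]"
  by (simp add: H_poly_def)

text \<open>
  The step of the descent, by comparison of the terms of degree \<open>2p\<close> and \<open>p + q + r\<close>, where \<open>p, q, r\<close> are the
  total degrees. If one of these numbers is the larger, the leading form of \<open>P \<nu>P\<close> or of \<open>P Q R\<close> is not cancelled,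
  although its degree exceeds that of \<open>H\<close>. Hence they agree; then \<open>q\<close> and \<open>r\<close> are smaller than \<open>p\<close>,
  so these two leading forms cancel each other, and dividing by the leading form of \<open>P\<close>
  shows that \<open>\<nu>P\<close> and \<open>Q R\<close> have the same leading form.
\<close>

lemma tdeg_reduction:
  assumes H: "P * nu P + Q * nu Q + R * nu R - P * Q * R = H_poly"
    and pos: "tdeg P > 0" "tdeg Q > 0" "tdeg R > 0"
    and le: "tdeg Q \<le> tdeg P" "tdeg R \<le> tdeg P" and large: "tdeg P + tdeg Q + tdeg R > 3"
  shows "tdeg (nu P - Q * R) < tdeg P"
proof -
  let ?p = "tdeg P" and ?q = "tdeg Q" and ?r = "tdeg R"
  define n where "n = max (2 * ?p) (?p + ?q + ?r)"
  have sq_top: "coeff (homog (f * nu f)) (2 * tdeg f) = lead_coeff (homog f) * nu (lead_coeff (homog f))" for f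
    using coeff_mult_degree_sum[of "homog f" "homog (nu f)"] by (simp add: coeff_homog_nu mult_2)
  have sq_0: "coeff (homog (f * nu f)) m = 0" if "2 * tdeg f < m" for f m
    using degree_mult_le[of "homog f" "homog (nu f)"] that by (intro coeff_eq_0) simp
  have deg_QR: "degree (homog Q * homog R) = ?q + ?r" if "coeff (homog Q * homog R) (?q + ?r) \<noteq> 0"
    using degree_mult_le[of "homog Q" "homog R"] le_degree[OF that] by simp
  have ne: "lead_coeff (homog P) \<noteq> 0" "lead_coeff (homog Q) \<noteq> 0" "lead_coeff (homog R) \<noteq> 0"
    using pos by (simp_all only: lead_coeff_nonzero not_False_eq_True)
  have QR_top: "coeff (homog (Q * R)) (?q + ?r) = lead_coeff (homog Q) * lead_coeff (homog R)"
    by (simp add: coeff_mult_degree_sum)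
  then have "coeff (homog (Q * R)) (?q + ?r) \<noteq> 0"
    using ne ring_R_no_zero_divisors by fastforce
  then have "degree (homog (Q * R)) = ?q + ?r"
    using deg_QR by simp
  then have PQR_top: "coeff (homog (P * Q * R)) (?p + ?q + ?r) =
      lead_coeff (homog P) * (lead_coeff (homog Q) * lead_coeff (homog R))"
    using coeff_mult_degree_sum[of "homog P" "homog (Q * R)"] QR_top by (simp add: mult.assoc add.assoc)
  have PQR_0: "coeff (homog (P * Q * R)) m = 0" if "?p + ?q + ?r < m" for m
  proof (rule coeff_eq_0)
    have "degree (homog P * homog Q * homog R) \<le> ?p + ?q + ?r"
      using degree_mult_le[of "homog P * homog Q" "homog R"] degree_mult_le[of "homog P" "homog Q"] by simp
    with that show "degree (homog (P * Q * R)) < m" by simp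
  qed
  have "coeff (homog H_poly) m = 0" if "m > 3" for m
    unfolding homog_H_poly using that by (intro coeff_eq_0) (simp add: degree_pCons_eq_if)
  then have cancel: "coeff (homog (P * nu P)) m + coeff (homog (Q * nu Q)) m + coeff (homog (R * nu R)) m
      = coeff (homog (P * Q * R)) m" if "m > 3" for m
    using that arg_cong[OF H, of "\<lambda>f. coeff (homog f) m"] by simp
  have two: "2 * ?p = ?p + ?q + ?r"
  proof (cases "2 * ?p" "?p + ?q + ?r" rule: linorder_cases)
    case less
    then have "coeff (homog (P * Q * R)) (?p + ?q + ?r) = 0"
      using cancel[OF large] le by (simp add: sq_0 del: homog.hom_mult)
    with PQR_top ne show ?thesis
      using ring_R_no_zero_divisors by metis
  next
    case greater
    then have "coeff (homog (P * nu P)) (2 * ?p) = 0"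
      using cancel[of "2 * ?p"] large by (simp add: sq_0 PQR_0 del: homog.hom_mult)
    with sq_top[of P] ne show ?thesis
      using ring_R_no_zero_divisors nu_eq_0_iff by metis
  qed
  then have p: "?p = ?q + ?r" by simp
  have "lead_coeff (homog P) * nu (lead_coeff (homog P)) =
      lead_coeff (homog P) * (lead_coeff (homog Q) * lead_coeff (homog R))"
    using cancel[of "2 * ?p"] p pos sq_top[of P] PQR_top[folded two] large
    by (simp add: sq_0 del: homog.hom_mult)
  then have "lead_coeff (homog P) * (nu (lead_coeff (homog P)) - lead_coeff (homog Q) * lead_coeff (homog R)) = 0"
    by (simp add: right_diff_distrib)
  then have "nu (lead_coeff (homog P)) = lead_coeff (homog Q) * lead_coeff (homog R)"
    using ne ring_R_no_zero_divisors by fastforce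
  then have top: "coeff (homog (nu P - Q * R)) ?p = 0"
    using QR_top p by (simp add: coeff_homog_nu)
  have "tdeg (nu P - Q * R) \<le> ?p"
    using degree_diff_le[of "homog (nu P)" ?p "homog Q * homog R"] degree_mult_le[of "homog Q" "homog R"] p
    by simp
  with top pos(1) show ?thesis
    by (metis degree_0 le_neq_implies_less leading_coeff_0_iff)
qed


section \<open>Triples of degree one\<close>

definition peval :: "(var \<Rightarrow> coeffs) \<Rightarrow> ring_R \<Rightarrow> coeffs" where
  "peval g = subst_poly (\<lambda>a. a) g"

lemma unital_ring_hom_ident: "unital_ring_hom (\<lambda>a. a)"
  by standard simp_all

interpretation peval: unital_ring_hom "peval g" for g
  unfolding peval_def by (rule unital_ring_hom_subst_poly[OF unital_ring_hom_ident])

lemma peval_const [simp]: "peval g (coeff_const a) = a"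
  and peval_xvar [simp]: "peval g (xvar v) = g v"
  unfolding peval_def by (simp_all add: unital_ring_hom_subst_poly[OF unital_ring_hom_ident])

text \<open>
  The substitution \<open>x\<^sub>v \<mapsto> 0\<close>. Its kernel is the prime ideal generated by \<open>x\<^sub>v\<close>, so it detects
  which factor of a product is divisible by \<open>x\<^sub>v\<close>.
\<close>

definition kill :: "var \<Rightarrow> ring_R \<Rightarrow> ring_R" where
  "kill v = subst_poly coeff_const (\<lambda>w. if w = v then 0 else xvar w)"

interpretation kill: unital_ring_hom "kill v" for v
  unfolding kill_def by (rule unital_ring_hom_subst_poly[OF unital_ring_hom_coeff_const])

lemma kill_const [simp]: "kill v (coeff_const a) = coeff_const a"
  and kill_xvar [simp]: "kill v (xvar w) = (if w = v then 0 else xvar w)"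
  unfolding kill_def by (simp_all add: unital_ring_hom_subst_poly[OF unital_ring_hom_coeff_const])

lemma lin_kill_eq_0:
  assumes "kill v (lin f) = 0"
  shows "\<exists>u. lin f = coeff_const u * xvar v"
proof -
  obtain a where a: "lin f = (\<Sum>w\<in>UNIV. coeff_const (a w) * xvar w)"
    using coeff_homog_1 unfolding lin_def by blast
  have "a w = 0" if "w \<noteq> v" for w
  proof -
    have "peval (\<lambda>x. if x = w then 1 else 0) (kill v (lin f)) =
        (\<Sum>x\<in>UNIV. if x = w then a x else 0)"
      unfolding a kill.hom_sum peval.hom_sum using that by (intro sum.cong) auto
    then show ?thesis
      by (simp add: assms)
  qed
  then have "lin f = (\<Sum>w\<in>UNIV. if w = v then coeff_const (a w) * xvar w else 0)"
    unfolding a by (intro sum.cong) auto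
  then show ?thesis
    by auto
qed

lemma lin_kill_two:
  assumes "kill v (lin f) = 0" "kill w (lin f) = 0" "v \<noteq> w"
  shows "lin f = 0"
  using lin_kill_eq_0[OF assms(1)] assms(2,3)
  by (metis kill.hom_mult kill_const kill_xvar)

text \<open>
  The units are \<open>\<plusminus>s\<^sub>3\<^sup>k\<close>, so \<open>u\<close> and \<open>w\<close> can be matched by some \<open>\<Lambda>\<^sub>i\<^sub>,\<^sub>j\<close> and \<open>M\<^sub>k\<^sub>,\<^sub>l\<close>; then \<open>v\<close> is
  matched too, because \<open>u v w = 1\<close> and the multipliers of each generator also have product 1.
\<close>

lemma diagonal_in_Gamma_M_aut:
  assumes \<phi>: "nu_endo \<phi>" "\<phi> (xvar V1) = coeff_const u * xvar V1"
    "\<phi> (xvar V3) = coeff_const v * xvar V3" "\<phi> (xvar V5) = coeff_const w * xvar V5"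
    and uvw: "u * v * w = 1"
  shows "\<phi> \<in> Gamma_M_aut"
proof -
  obtain i k where u: "u = (- 1) ^ i * sym3_pow k" "i \<in> {0, 1}"
    using coeffs_unit[of u "v * w"] uvw by (metis mult.assoc)
  obtain j l where w: "w = (- 1) ^ j * sym3_pow l" "j \<in> {0, 1}"
    using coeffs_unit[of w "u * v"] uvw by (metis mult.commute)
  define v' where "v' = (- 1) ^ (i + j) * sym3_pow (- k - l)"
  have sign: "(- 1 :: coeffs) ^ n * (- 1) ^ n = 1" for n
    by (simp flip: power_add mult_2)
  have "u * v' * w = ((- 1) ^ i * (- 1) ^ i) * ((- 1) ^ j * (- 1) ^ j) *
      (sym3_pow k * sym3_pow (- k - l) * sym3_pow l)"
    unfolding u(1) w(1) v'_def power_add by (simp only: mult_ac)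
  also have "\<dots> = 1"
    by (simp only: sign flip: sym3_pow_add) (simp add: sym3_pow_0)
  finally have "u * v' * w = 1" .
  have "v = v * (u * v' * w)"
    by (simp only: \<open>u * v' * w = 1\<close> mult_1_right)
  also have "\<dots> = v' * (u * v * w)"
    by (simp only: mult_ac)
  finally have v: "v = v'"
    by (simp only: uvw mult_1_right)
  have mem: "Lambda_gen i j \<in> Markov_gens" "M_gen (- k) (- l) \<in> Markov_gens"
    using u(2) w(2) by (simp_all add: Markov_gens_simps)
  interpret Lambda: unital_ring_hom "Lambda_gen i j"
    using nu_auto_generators(1)[of i j] by (intro nu_endo_hom) (simp add: nu_auto_def)
  have "\<phi> = Lambda_gen i j \<circ> M_gen (- k) (- l)"
  proof (rule nu_endo_eqI[OF \<phi>(1)])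
    show "nu_endo (Lambda_gen i j \<circ> M_gen (- k) (- l))"
      using nu_auto_generators by (intro nu_endo_comp) (simp_all add: nu_auto_def)
    have "Lambda_gen i j (coeff_const a) = coeff_const a" for a
      by (simp add: Lambda_gen_def)
    moreover have "Lambda_gen i j (xvar V1) = (- 1) ^ i * xvar V1"
      "Lambda_gen i j (xvar V3) = (- 1) ^ (i + j) * xvar V3"
      "Lambda_gen i j (xvar V5) = (- 1) ^ j * xvar V5"
      by (simp_all add: Lambda_gen_def)
    ultimately show "\<phi> (xvar V1) = (Lambda_gen i j \<circ> M_gen (- k) (- l)) (xvar V1)"
      "\<phi> (xvar V3) = (Lambda_gen i j \<circ> M_gen (- k) (- l)) (xvar V3)"
      "\<phi> (xvar V5) = (Lambda_gen i j \<circ> M_gen (- k) (- l)) (xvar V5)"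
      by (simp_all add: \<phi> u(1) w(1) v v'_def M_gen_def mult_ac)
  qed
  then show ?thesis
    using mem generators_in_Gamma_M_aut comp_in_Gamma_M_aut by blast
qed

lemma Gamma_max_equation:
  assumes "\<phi> \<in> Gamma_max"
  defines "P \<equiv> \<phi> (xvar V1)" and "Q \<equiv> \<phi> (xvar V3)" and "R \<equiv> \<phi> (xvar V5)"
  shows "P * nu P + Q * nu Q + R * nu R - P * Q * R = H_poly"
proof -
  have \<phi>: "nu_endo \<phi>" "\<phi> H_poly = H_poly"
    using assms by (auto simp: Gamma_max_def)
  have "endo_of P Q R = \<phi>"
    by (rule nu_endo_eqI) (simp_all add: \<phi> nu_endo_endo_of P_def Q_def R_def)
  then show ?thesis
    using \<phi>(2) endo_of_H_poly by metis
qed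

text \<open>
  The two top coefficients in \<open>t\<close> of the left-hand side of the equation for affine \<open>P, Q, R\<close>.
\<close>

lemma affine_product:
  fixes a :: "'a::comm_ring_1"
  assumes "[:a, b:] * [:a', b':] + [:c, d:] * [:c', d':] + [:e, f:] * [:e', f':]
    - [:a, b:] * [:c, d:] * [:e, f:] = [:0, 0, x, y:]"
  shows "b * b' + d * d' + f * f' - (a * d * f + b * c * f + b * d * e) = x" "- (b * d * f) = y"
  using assms by (auto simp: algebra_simps)

locale degree_one_triple =
  fixes P Q R :: ring_R
  assumes H: "P * nu P + Q * nu Q + R * nu R - P * Q * R = H_poly"
    and deg: "tdeg P = 1" "tdeg Q = 1" "tdeg R = 1"
begin

lemma homogeneous_parts:
  obtains a b c where "P = coeff_const a + lin P" "Q = coeff_const b + lin Q" "R = coeff_const c + lin R"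
    "lin P * nu (lin P) + lin Q * nu (lin Q) + lin R * nu (lin R)
      - (coeff_const a * lin Q * lin R + lin P * coeff_const b * lin R + lin P * lin Q * coeff_const c)
      = xvar V1 * xvar V2 + xvar V3 * xvar V4 + xvar V5 * xvar V6"
    "lin P * lin Q * lin R = xvar V1 * xvar V3 * xvar V5"
proof -
  obtain a where a: "homog P = [:coeff_const a, lin P:]" "P = coeff_const a + lin P"
    by (rule homog_tdeg_1[OF deg(1)])
  obtain b where b: "homog Q = [:coeff_const b, lin Q:]" "Q = coeff_const b + lin Q"
    by (rule homog_tdeg_1[OF deg(2)])
  obtain c where c: "homog R = [:coeff_const c, lin R:]" "R = coeff_const c + lin R"
    by (rule homog_tdeg_1[OF deg(3)])
  have nu: "homog (nu f) = [:nu x, nu y:]" if "homog f = [:x, y:]" for f x y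
    by (rule poly_eqI) (simp add: coeff_homog_nu that coeff_pCons split: nat.split)
  have "homog P * homog (nu P) + homog Q * homog (nu Q) + homog R * homog (nu R)
      - homog P * homog Q * homog R = homog H_poly"
    using arg_cong[OF H, of homog] by simp
  note eq = affine_product[OF this[unfolded nu[OF a(1)] nu[OF b(1)] nu[OF c(1)], unfolded a(1) b(1) c(1) homog_H_poly]]
  show ?thesis
    by (rule that[OF a(2) b(2) c(2) eq(1)]) (use eq(2) in simp)
qed

lemma lin_product: "lin P * lin Q * lin R = xvar V1 * xvar V3 * xvar V5"
  using homogeneous_parts by metis

lemma lin_nonzero: "lin P \<noteq> 0" "lin Q \<noteq> 0" "lin R \<noteq> 0"
  unfolding lin_def using deg by (metis degree_0 leading_coeff_0_iff zero_neq_one)+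

text \<open>
  The linear parts have the product \<open>x\<^sub>1 x\<^sub>3 x\<^sub>5\<close>, and \<open>x\<^sub>v\<close> is prime.
\<close>

lemma kill_some_lin:
  assumes "v \<in> {V1, V3, V5}"
  shows "kill v (lin P) = 0 \<or> kill v (lin Q) = 0 \<or> kill v (lin R) = 0"
proof -
  have "kill v (lin P) * kill v (lin Q) * kill v (lin R) = kill v (xvar V1 * xvar V3 * xvar V5)"
    by (simp flip: lin_product)
  also have "\<dots> = 0"
    using assms by auto
  finally show ?thesis
    using ring_R_no_zero_divisors by metis
qed

text \<open>
  The constants \<open>a, b, c\<close> of the affine polynomials contribute \<open>a v w x\<^sub>3 x\<^sub>5\<close>, \<open>u b w x\<^sub>1 x\<^sub>5\<close> and
  \<open>u v c x\<^sub>1 x\<^sub>3\<close> to the degree 2 part, and neither \<open>H\<close> nor the products \<open>P \<nu>P\<close>, \<open>Q \<nu>Q\<close>, \<open>R \<nu>R\<close>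
  contain these monomials.
\<close>

lemma diagonal:
  assumes "kill V1 (lin P) = 0" "kill V3 (lin Q) = 0" "kill V5 (lin R) = 0"
  obtains u v w where "P = coeff_const u * xvar V1" "Q = coeff_const v * xvar V3"
    "R = coeff_const w * xvar V5" "u * v * w = 1"
proof -
  obtain u v w where lin: "lin P = coeff_const u * xvar V1" "lin Q = coeff_const v * xvar V3"
    "lin R = coeff_const w * xvar V5"
    using assms lin_kill_eq_0 by metis
  obtain a b c where abc: "P = coeff_const a + lin P" "Q = coeff_const b + lin Q" "R = coeff_const c + lin R"
    and quad: "lin P * nu (lin P) + lin Q * nu (lin Q) + lin R * nu (lin R)
      - (coeff_const a * lin Q * lin R + lin P * coeff_const b * lin R + lin P * lin Q * coeff_const c)
      = xvar V1 * xvar V2 + xvar V3 * xvar V4 + xvar V5 * xvar V6"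
    by (rule homogeneous_parts)
  have "peval (\<lambda>_. 1) (lin P * lin Q * lin R) = 1"
    by (simp only: lin_product) simp
  then have uvw: "u * v * w = 1"
    by (simp add: lin)
  \<comment> \<open>Evaluation at the indicator function of two variables isolates the coefficient of their product.\<close>
  have at: "peval (\<lambda>x. if x \<in> S then 1 else 0) (lin P * nu (lin P) + lin Q * nu (lin Q) + lin R * nu (lin R)
      - (coeff_const a * lin Q * lin R + lin P * coeff_const b * lin R + lin P * lin Q * coeff_const c))
      = peval (\<lambda>x. if x \<in> S then 1 else 0)
        (xvar V1 * xvar V2 + xvar V3 * xvar V4 + xvar V5 * xvar V6)" for S
    by (simp only: quad)
  have "a * v * w = 0" "u * b * w = 0" "u * v * c = 0"
    using at[of "{V3, V5}"] at[of "{V1, V5}"] at[of "{V1, V3}"] by (simp_all add: lin)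
  moreover have "u \<noteq> 0" "v \<noteq> 0" "w \<noteq> 0"
    using uvw by auto
  ultimately have "a = 0" "b = 0" "c = 0"
    using coeffs_no_zero_divisors by metis+
  then have "P = lin P" "Q = lin Q" "R = lin R"
    using abc by (metis add_0 coeff_const.hom_zero)+
  then show ?thesis
    using that[of u v w] uvw lin by metis
qed

end

lemma sorted_degree_one_in_Gamma_M_aut:
  assumes \<phi>: "\<phi> \<in> Gamma_max"
    and deg: "tdeg (\<phi> (xvar V1)) = 1" "tdeg (\<phi> (xvar V3)) = 1" "tdeg (\<phi> (xvar V5)) = 1"
    and kill: "kill V1 (lin (\<phi> (xvar V1))) = 0" "kill V3 (lin (\<phi> (xvar V3))) = 0"
      "kill V5 (lin (\<phi> (xvar V5))) = 0"
  shows "\<phi> \<in> Gamma_M_aut"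
proof -
  interpret degree_one_triple "\<phi> (xvar V1)" "\<phi> (xvar V3)" "\<phi> (xvar V5)"
    by (intro degree_one_triple.intro Gamma_max_equation \<phi> deg)
  have "nu_endo \<phi>"
    using \<phi> by (simp add: Gamma_max_def)
  then show ?thesis
    using diagonal[OF kill] diagonal_in_Gamma_M_aut by metis
qed

section \<open>Descent\<close>

lemma Gamma_M_aut_if_comp:
  assumes "\<psi> \<in> Markov_gens" "\<phi> \<circ> \<psi> \<in> Gamma_M_aut"
  shows "\<phi> \<in> Gamma_M_aut"
  using assms generators_in_Gamma_M_aut Gamma_M_aut_cancel_right by blast

lemma Gamma_max_comp_gen: "\<phi> \<in> Gamma_max \<Longrightarrow> \<psi> \<in> Markov_gens \<Longrightarrow> \<phi> \<circ> \<psi> \<in> Gamma_max"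
  using Gamma_max_comp_G_Hor Markov_gens_subset by blast

lemma Sigma_images:
  "(\<phi> \<circ> Sigma1_gen) (xvar V1) = \<phi> (xvar V3)" "(\<phi> \<circ> Sigma1_gen) (xvar V3) = \<phi> (xvar V1)"
  "(\<phi> \<circ> Sigma1_gen) (xvar V5) = \<phi> (xvar V5)"
  "(\<phi> \<circ> Sigma2_gen) (xvar V1) = \<phi> (xvar V1)" "(\<phi> \<circ> Sigma2_gen) (xvar V3) = \<phi> (xvar V5)"
  "(\<phi> \<circ> Sigma2_gen) (xvar V5) = \<phi> (xvar V3)"
  by (simp_all add: Sigma1_gen_def Sigma2_gen_def)

text \<open>
  Each of \<open>x\<^sub>1, x\<^sub>3, x\<^sub>5\<close> divides one of the three linear parts, and none of these is divisible by two
  variables. So the linear parts match the variables by one of the six permutations, which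
  \<open>\<Sigma>\<^sub>1\<close> and \<open>\<Sigma>\<^sub>2\<close> undo.
\<close>

lemma degree_one_in_Gamma_M_aut:
  assumes \<phi>: "\<phi> \<in> Gamma_max"
    and deg: "tdeg (\<phi> (xvar V1)) = 1" "tdeg (\<phi> (xvar V3)) = 1" "tdeg (\<phi> (xvar V5)) = 1"
  shows "\<phi> \<in> Gamma_M_aut"
proof -
  let ?z = "\<lambda>v w. kill v (lin (\<phi> (xvar w))) = 0"
  have S: "Sigma1_gen \<in> Markov_gens" "Sigma2_gen \<in> Markov_gens"
    by (fact Markov_gens_simps)+
  note sorted = sorted_degree_one_in_Gamma_M_aut
  note comp = Gamma_M_aut_if_comp[OF S(1)] Gamma_M_aut_if_comp[OF S(2)]
  note closed = Gamma_max_comp_gen[OF _ S(1)] Gamma_max_comp_gen[OF _ S(2)]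
  interpret degree_one_triple "\<phi> (xvar V1)" "\<phi> (xvar V3)" "\<phi> (xvar V5)"
    by (intro degree_one_triple.intro Gamma_max_equation \<phi> deg)
  have uniq: "\<not> (?z v x \<and> ?z w x)" if "v \<noteq> w" "x \<in> {V1, V3, V5}" for v w x
    using that lin_nonzero lin_kill_two by blast
  have some: "?z v V1 \<or> ?z v V3 \<or> ?z v V5" if "v \<in> {V1, V3, V5}" for v
    using kill_some_lin[OF that] .
  consider "?z V1 V1" "?z V3 V3" "?z V5 V5" | "?z V1 V3" "?z V3 V1" "?z V5 V5"
    | "?z V1 V1" "?z V3 V5" "?z V5 V3" | "?z V1 V3" "?z V3 V5" "?z V5 V1"
    | "?z V1 V5" "?z V3 V1" "?z V5 V3" | "?z V1 V5" "?z V3 V3" "?z V5 V1"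
    using some[of V1] some[of V3] some[of V5] uniq[of V1 V3 V1] uniq[of V1 V3 V3] uniq[of V1 V3 V5]
      uniq[of V1 V5 V1] uniq[of V1 V5 V3] uniq[of V1 V5 V5] uniq[of V3 V5 V1] uniq[of V3 V5 V3]
      uniq[of V3 V5 V5]
    by simp argo
  then show ?thesis
  proof cases
    case 1
    then show ?thesis using \<phi> deg by (intro sorted)
  next
    case 2
    then have "\<phi> \<circ> Sigma1_gen \<in> Gamma_M_aut"
      using \<phi> deg by (intro sorted closed) (simp_all only: Sigma_images)
    then show ?thesis by (rule comp(1))
  next
    case 3
    then have "\<phi> \<circ> Sigma2_gen \<in> Gamma_M_aut"
      using \<phi> deg by (intro sorted closed) (simp_all only: Sigma_images)
    then show ?thesis by (rule comp(2))
  next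
    case 4
    then have "(\<phi> \<circ> Sigma1_gen) \<circ> Sigma2_gen \<in> Gamma_M_aut"
      using \<phi> deg by (intro sorted closed) (simp_all only: Sigma_images)
    then show ?thesis by (rule comp(1)[OF comp(2)])
  next
    case 5
    then have "(\<phi> \<circ> Sigma2_gen) \<circ> Sigma1_gen \<in> Gamma_M_aut"
      using \<phi> deg by (intro sorted closed) (simp_all only: Sigma_images)
    then show ?thesis by (rule comp(2)[OF comp(1)])
  next
    case 6
    then have "((\<phi> \<circ> Sigma1_gen) \<circ> Sigma2_gen) \<circ> Sigma1_gen \<in> Gamma_M_aut"
      using \<phi> deg by (intro sorted closed) (simp_all only: Sigma_images)
    then show ?thesis by (rule comp(1)[OF comp(2)[OF comp(1)]])
  qed
qed

text \<open>
  Up to order, signs and \<open>\<nu>\<close>, composition with \<open>T\<^sub>1\<close> replaces \<open>R\<close> by \<open>\<nu>R - P Q\<close> and composition with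
  \<open>T\<^sub>2\<close> replaces \<open>Q\<close> by \<open>\<nu>Q - P R\<close>; these are the two directions of the descent.
\<close>

lemma T_images:
  assumes "nu_endo \<phi>"
  defines "P \<equiv> \<phi> (xvar V1)" and "Q \<equiv> \<phi> (xvar V3)" and "R \<equiv> \<phi> (xvar V5)"
  shows "(\<phi> \<circ> T1_gen) (xvar V1) = - nu P" "(\<phi> \<circ> T1_gen) (xvar V3) = nu R - P * Q"
    "(\<phi> \<circ> T1_gen) (xvar V5) = nu Q"
    "(\<phi> \<circ> T2_gen) (xvar V1) = nu Q - P * R" "(\<phi> \<circ> T2_gen) (xvar V3) = nu P"
    "(\<phi> \<circ> T2_gen) (xvar V5) = - nu R"
proof -
  interpret unital_ring_hom \<phi> using assms(1) by (rule nu_endo_hom)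
  show "(\<phi> \<circ> T1_gen) (xvar V1) = - nu P" "(\<phi> \<circ> T1_gen) (xvar V3) = nu R - P * Q"
    "(\<phi> \<circ> T1_gen) (xvar V5) = nu Q"
    "(\<phi> \<circ> T2_gen) (xvar V1) = nu Q - P * R" "(\<phi> \<circ> T2_gen) (xvar V3) = nu P"
    "(\<phi> \<circ> T2_gen) (xvar V5) = - nu R"
    by (simp_all add: T1_gen_def T2_gen_def P_def Q_def R_def del: nu_xvar
        flip: nu_endo_nu[OF assms(1)]) simp_all
qed

lemma Gamma_max_subset_Gamma_M_aut: "Gamma_max \<subseteq> Gamma_M_aut"
proof
  fix \<phi> assume "\<phi> \<in> Gamma_max"
  then show "\<phi> \<in> Gamma_M_aut"
  proof (induction "tdeg (\<phi> (xvar V1)) + tdeg (\<phi> (xvar V3)) + tdeg (\<phi> (xvar V5))"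
      arbitrary: \<phi> rule: less_induct)
    case less
    let ?P = "\<phi> (xvar V1)" and ?Q = "\<phi> (xvar V3)" and ?R = "\<phi> (xvar V5)"
    have \<phi>: "\<phi> \<in> Gamma_max" "nu_endo \<phi>"
      using less.prems by (auto simp: Gamma_max_def)
    have gens: "Sigma1_gen \<in> Markov_gens" "T1_gen \<in> Markov_gens" "T2_gen \<in> Markov_gens"
      by (fact Markov_gens_simps)+
    have pos: "tdeg (\<phi> (xvar v)) > 0" for v
      using tdeg_0_const Gamma_max_not_const[OF \<phi>(1)] by blast
    have H: "?P * nu ?P + ?Q * nu ?Q + ?R * nu ?R - ?P * ?Q * ?R = H_poly"
      by (rule Gamma_max_equation[OF \<phi>(1)])
    have smaller: "\<psi> \<in> Gamma_M_aut"
      if "\<psi> \<in> Gamma_max" "tdeg (\<psi> (xvar V1)) + tdeg (\<psi> (xvar V3)) + tdeg (\<psi> (xvar V5))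
        < tdeg ?P + tdeg ?Q + tdeg ?R" for \<psi>
      using less.hyps[OF that(2,1)] .
    show ?case
    proof (cases "tdeg ?P + tdeg ?Q + tdeg ?R \<le> 3")
      case True
      then show ?thesis
        using pos[of V1] pos[of V3] pos[of V5] by (intro degree_one_in_Gamma_M_aut \<phi>) linarith+
    next
      case False
      consider (R) "tdeg ?P \<le> tdeg ?R" "tdeg ?Q \<le> tdeg ?R"
        | (Q) "tdeg ?P \<le> tdeg ?Q" "tdeg ?R \<le> tdeg ?Q"
        | (P) "tdeg ?Q \<le> tdeg ?P" "tdeg ?R \<le> tdeg ?P"
        by linarith
      then show ?thesis
      proof cases
        case R
        have "tdeg (nu ?R - ?P * ?Q) < tdeg ?R"
          using R H False by (intro tdeg_reduction pos) (auto simp: algebra_simps)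
        then have "\<phi> \<circ> T1_gen \<in> Gamma_M_aut"
          by (intro smaller Gamma_max_comp_gen \<phi> gens)
            (simp only: T_images[OF \<phi>(2)], simp only: homog.hom_uminus degree_minus tdeg_nu)
        then show ?thesis
          by (rule Gamma_M_aut_if_comp[OF gens(2)])
      next
        case Q
        have "tdeg (nu ?Q - ?P * ?R) < tdeg ?Q"
          using Q H False by (intro tdeg_reduction pos) (auto simp: algebra_simps)
        then have "\<phi> \<circ> T2_gen \<in> Gamma_M_aut"
          by (intro smaller Gamma_max_comp_gen \<phi> gens)
            (simp only: T_images[OF \<phi>(2)], simp only: homog.hom_uminus degree_minus tdeg_nu)
        then show ?thesis
          by (rule Gamma_M_aut_if_comp[OF gens(3)])
      next
        case P
        \<comment> \<open>Neither \<open>T\<^sub>1\<close> nor \<open>T\<^sub>2\<close> reduces \<open>P\<close> itself, so \<open>\<Sigma>\<^sub>1\<close> first moves it to the place of \<open>Q\<close>.\<close>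
        have \<phi>1: "\<phi> \<circ> Sigma1_gen \<in> Gamma_max"
          by (rule Gamma_max_comp_gen[OF \<phi>(1) gens(1)])
        then have endo: "nu_endo (\<phi> \<circ> Sigma1_gen)"
          by (simp add: Gamma_max_def)
        have "tdeg (nu ?P - ?Q * ?R) < tdeg ?P"
          using P H False by (intro tdeg_reduction pos) (auto simp: algebra_simps)
        then have "(\<phi> \<circ> Sigma1_gen) \<circ> T2_gen \<in> Gamma_M_aut"
          by (intro smaller Gamma_max_comp_gen \<phi> gens)
            (simp only: T_images[OF endo] Sigma_images, simp only: homog.hom_uminus degree_minus tdeg_nu)
        then show ?thesis
          using Gamma_M_aut_if_comp gens by blast
      qed
    qed
  qed
qed

theorem theorem12p5:
  shows "Gamma_M_aut = G_Hor \<and> G_Hor = Gamma_max \<and> (\<forall>\<phi>\<in>Gamma_max. nu_auto \<phi>)"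
proof -
  have "Gamma_M_aut = G_Hor" "G_Hor = Gamma_max"
    using Gamma_M_aut_subset_G_Hor G_Hor_subset_Gamma_max Gamma_max_subset_Gamma_M_aut by auto
  then show ?thesis
    by (auto simp: G_Hor_def)
qed

end
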